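(* Let $\mathcal{A}^{\mathbb{Z}}$ be any Abelian group shift, let $(\mathcal{A}^{\mathbb{Z}},F)$ be a nontrivial algebraic bipermutative cellular automaton (without restriction on the neighborhood) and let $\mu$ be an $(F,\sigma)$-invariant Borel probability measure on $\mathcal{A}^{\mathbb{Z}}$. Assume that: 1. $\mu$ is totally ergodic for $\sigma$ (i.e. ergodic for $\sigma^n$ for every $n\ge 1$); 2. the measure entropy $h_\mu(F)$ is positive; 3. $\mathrm{Ker}(F)$ contains no nontrivial $\sigma$-invariant subgroup (i.e. its only $\sigma$-invariant subgroups are $\{0\}$ and $\mathrm{Ker}(F)$). Then $\mu=\lambda_{\mathcal{A}^{\mathbb{Z}}}$, the Haar measure of $\mathcal{A}^{\mathbb{Z}}$.
   Context: $\mathcal{A}$ is a finite set, $\mathcal{A}^{\mathbb{Z}}$ has the product topology, and $\sigma(x)_i=x_{i+1}$ is the shift. A cellular automaton (CA) is a continuous map $F:\mathcal{A}^{\mathbb{Z}}\to\mathcal{A}^{\mathbb{Z}}$ commuting with $\sigma$; equivalently there are a finite interval $\mathbb{U}\subset\mathbb{Z}$ and a local rule $\overline{F}:\mathcal{A}^{\mathbb{U}}\to\mathcal{A}$ with $F(x)_m=\overline{F}((x_{m+u})_{u\in\mathbb{U}})$; the smallest such interval is the smallest neighborhood. $F$ is nontrivial if its smallest neighborhood is not a single point. With smallest neighborhood $[r,s]$, $F$ is bipermutative if for all $u\in\mathcal{A}^{s-r}$, $b\in\mathcal{A}$ there is a unique $a\in\mathcal{A}$ with $\overline{F}(au)=b$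 and a unique $a'\in\mathcal{A}$ with $\overline{F}(ua')=b$. $\mathcal{A}^{\mathbb{Z}}$ is an Abelian group shift if it carries an Abelian topological group structure (not necessarily a product structure) for which $\sigma$ is a continuous group endomorphism; a CA on it is algebraic if it is a group endomorphism. $\mu$ is $(F,\sigma)$-invariant if $\mu(F^{-1}B)=\mu(\sigma^{-1}B)=\mu(B)$ for all Borel $B$. A subgroup $\Gamma$ is $\sigma$-invariant if $\sigma(\Gamma)=\Gamma$. $h_\mu(F)$ is the Kolmogorov–Sinai entropy. *)

theory Defs
  imports "HOL-Probability.Probability_Measure" "HOL-Algebra.Coset"
begin

section \<open>The full shift\<close>

text \<open>The alphabet is a finite type with the discrete topology.  The topology on
  \<^typ>\<open>int \<Rightarrow> 'a\<close> is then the library's product topology, and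
  \<open>borel :: (int \<Rightarrow> 'a) measure\<close> carries its Borel sigma-algebra.\<close>

class alphabet = finite + discrete_topology

instance alphabet \<subseteq> second_countable_topology
proof
  have "open S = generate_topology (UNIV :: 'a::alphabet set set) S" for S
    by (simp add: Topological_Spaces.open_discrete generate_topology.Basis)
  moreover have "countable (UNIV :: 'a::alphabet set set)"
    by (simp add: countable_finite)
  ultimately show "\<exists>B::'a::alphabet set set. countable B \<and> open = generate_topology B"
    by (intro exI[of _ UNIV]) (auto simp: fun_eq_iff)
qed

definition shift_map :: "(int \<Rightarrow> 'a) \<Rightarrow> (int \<Rightarrow> 'a)" where
  "shift_map x = (\<lambda>i. x (i + 1))"

section \<open>Cellular automata\<close>

definition cellular_automaton :: "((int \<Rightarrow> 'a::alphabet) \<Rightarrow> (int \<Rightarrow> 'a)) \<Rightarrow> bool" where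
  "cellular_automaton F \<longleftrightarrow> continuous_on UNIV F \<and> (\<forall>x. F (shift_map x) = shift_map (F x))"

text \<open>Elements of \<open>A\<^bsup>[r,s]\<^esup>\<close> are words of length \<open>s - r + 1\<close>, encoded as lists with the letter at
  position \<open>r\<close> first.  The values of \<open>f\<close> on lists of any other length play no role.\<close>

definition local_rule ::
    "((int \<Rightarrow> 'a) \<Rightarrow> (int \<Rightarrow> 'a)) \<Rightarrow> int \<Rightarrow> int \<Rightarrow> ('a list \<Rightarrow> 'a) \<Rightarrow> bool" where
  "local_rule F r s f \<longleftrightarrow> (\<forall>x m. F x m = f (map (\<lambda>u. x (m + u)) [r..s]))"

definition neighborhood :: "((int \<Rightarrow> 'a) \<Rightarrow> (int \<Rightarrow> 'a)) \<Rightarrow> int \<Rightarrow> int \<Rightarrow> bool" where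
  "neighborhood F r s \<longleftrightarrow> r \<le> s \<and> (\<exists>f. local_rule F r s f)"

text \<open>Only nonempty intervals are considered, so a constant map, for which every interval is a
  neighborhood, has no smallest one; every other cellular automaton has one.\<close>

definition smallest_neighborhood :: "((int \<Rightarrow> 'a) \<Rightarrow> (int \<Rightarrow> 'a)) \<Rightarrow> int \<Rightarrow> int \<Rightarrow> bool" where
  "smallest_neighborhood F r s \<longleftrightarrow>
     neighborhood F r s \<and> (\<forall>r' s'. neighborhood F r' s' \<longrightarrow> {r..s} \<subseteq> {r'..s'})"

definition nontrivial_ca :: "((int \<Rightarrow> 'a) \<Rightarrow> (int \<Rightarrow> 'a)) \<Rightarrow> bool" where
  "nontrivial_ca F \<longleftrightarrow> (\<exists>r s. smallest_neighborhood F r s \<and> r \<noteq> s)"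

definition bipermutative :: "((int \<Rightarrow> 'a) \<Rightarrow> (int \<Rightarrow> 'a)) \<Rightarrow> bool" where
  "bipermutative F \<longleftrightarrow>
     (\<exists>r s f. smallest_neighborhood F r s \<and> local_rule F r s f \<and>
        (\<forall>u b. length u = nat (s - r) \<longrightarrow>
           (\<exists>!a. f (a # u) = b) \<and> (\<exists>!a. f (u @ [a]) = b)))"

section \<open>Abelian group shifts\<close>

definition abelian_group_shift :: "(int \<Rightarrow> 'a::alphabet) monoid \<Rightarrow> bool" where
  "abelian_group_shift G \<longleftrightarrow>
     comm_group G \<and> carrier G = UNIV \<and>
     continuous_on UNIV (\<lambda>(x, y). x \<otimes>\<^bsub>G\<^esub> y) \<and>
     continuous_on UNIV (\<lambda>x. inv\<^bsub>G\<^esub> x) \<and>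
     continuous_on UNIV (shift_map :: (int \<Rightarrow> 'a) \<Rightarrow> (int \<Rightarrow> 'a)) \<and>
     shift_map \<in> hom G G"

definition algebraic_ca ::
    "(int \<Rightarrow> 'a::alphabet) monoid \<Rightarrow> ((int \<Rightarrow> 'a) \<Rightarrow> (int \<Rightarrow> 'a)) \<Rightarrow> bool" where
  "algebraic_ca G F \<longleftrightarrow> cellular_automaton F \<and> F \<in> hom G G"

definition borel_probability :: "'x::topological_space measure \<Rightarrow> bool" where
  "borel_probability \<mu> \<longleftrightarrow> prob_space \<mu> \<and> sets \<mu> = sets borel"

definition haar_probability :: "(int \<Rightarrow> 'a::alphabet) monoid \<Rightarrow> (int \<Rightarrow> 'a) measure \<Rightarrow> bool" where
  "haar_probability G \<nu> \<longleftrightarrow> borel_probability \<nu> \<and>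
     (\<forall>g\<in>carrier G. \<forall>B\<in>sets borel. emeasure \<nu> ((\<lambda>x. g \<otimes>\<^bsub>G\<^esub> x) -` B) = emeasure \<nu> B)"

text \<open>Well defined by existence and uniqueness of normalized Haar measure on a compact group;
  uniqueness is proved below.\<close>

definition haar_measure :: "(int \<Rightarrow> 'a::alphabet) monoid \<Rightarrow> (int \<Rightarrow> 'a) measure" where
  "haar_measure G = (THE \<nu>. haar_probability G \<nu>)"

lemma haar_probability_unique:
  fixes G :: "(int \<Rightarrow> 'a::alphabet) monoid"
  assumes G: "abelian_group_shift G" and m: "haar_probability G \<mu>" and n: "haar_probability G \<nu>"
  shows "\<mu> = \<nu>"
proof (rule measure_eqI)
  have sm [measurable_cong]: "sets \<mu> = sets borel" and sn [measurable_cong]: "sets \<nu> = sets borel"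
    using m n by (auto simp: haar_probability_def borel_probability_def)
  interpret M: prob_space \<mu> using m by (simp add: haar_probability_def borel_probability_def)
  interpret N: prob_space \<nu> using n by (simp add: haar_probability_def borel_probability_def)
  interpret P: pair_sigma_finite \<mu> \<nu> ..
  interpret G: comm_group G using G by (simp add: abelian_group_shift_def)
  have c: "carrier G = UNIV" using G by (simp add: abelian_group_shift_def)
  have spm: "space \<mu> = UNIV" "space \<nu> = UNIV"
    using sets_eq_imp_space_eq[OF sm] sets_eq_imp_space_eq[OF sn] by auto
  show "sets \<mu> = sets \<nu>" using sm sn by simp
  fix B assume "B \<in> sets \<mu>"
  then have B [measurable]: "B \<in> sets borel" using sm by simp
  have mult: "(\<lambda>(x, y). x \<otimes>\<^bsub>G\<^esub> y) \<in> borel_measurable (borel \<Otimes>\<^sub>M borel)"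
    unfolding borel_prod using G by (auto simp: abelian_group_shift_def intro: borel_measurable_continuous_onI)
  have meas: "(\<lambda>(x, y). indicator B (x \<otimes>\<^bsub>G\<^esub> y) :: ennreal) \<in> borel_measurable (\<mu> \<Otimes>\<^sub>M \<nu>)"
    using measurable_compose[OF mult borel_measurable_indicator[OF B]]
    by (simp add: split_def measurable_cong_sets[OF sets_pair_measure_cong[OF sm sn] refl])
  have tr: "(\<integral>\<^sup>+ y. indicator B (g \<otimes>\<^bsub>G\<^esub> y) \<partial>\<rho>) = emeasure \<rho> B"
    if r: "haar_probability G \<rho>" for \<rho> g
  proof -
    have sr: "sets \<rho> = sets borel" using r by (auto simp: haar_probability_def borel_probability_def)
    have "(\<lambda>x. (g, x)) \<in> borel \<rightarrow>\<^sub>M (borel \<Otimes>\<^sub>M borel)" by simp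
    from measurable_compose[OF this mult]
    have "(\<lambda>x. g \<otimes>\<^bsub>G\<^esub> x) -` B \<in> sets borel" using measurable_sets[OF _ B, of "\<lambda>x. g \<otimes>\<^bsub>G\<^esub> x" borel] by simp
    then have "(\<integral>\<^sup>+ y. indicator ((\<lambda>x. g \<otimes>\<^bsub>G\<^esub> x) -` B) y \<partial>\<rho>) = emeasure \<rho> ((\<lambda>x. g \<otimes>\<^bsub>G\<^esub> x) -` B)"
      by (intro nn_integral_indicator) (simp add: sr)
    moreover have "indicator ((\<lambda>x. g \<otimes>\<^bsub>G\<^esub> x) -` B) y = (indicator B (g \<otimes>\<^bsub>G\<^esub> y) :: ennreal)" for y
      by (simp add: indicator_def)
    ultimately show ?thesis using r B c by (simp add: haar_probability_def)
  qed
  have "emeasure \<nu> B = (\<integral>\<^sup>+ x. \<integral>\<^sup>+ y. indicator B (x \<otimes>\<^bsub>G\<^esub> y) \<partial>\<nu> \<partial>\<mu>)"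
    using tr[OF n] M.emeasure_space_1 by simp
  also have "\<dots> = (\<integral>\<^sup>+ y. \<integral>\<^sup>+ x. indicator B (x \<otimes>\<^bsub>G\<^esub> y) \<partial>\<mu> \<partial>\<nu>)"
    using P.Fubini'[OF meas] by simp
  also have "\<dots> = (\<integral>\<^sup>+ y. \<integral>\<^sup>+ x. indicator B (y \<otimes>\<^bsub>G\<^esub> x) \<partial>\<mu> \<partial>\<nu>)"
    using G.m_comm c by simp
  also have "\<dots> = emeasure \<mu> B"
    using tr[OF m] N.emeasure_space_1 by simp
  finally show "emeasure \<mu> B = emeasure \<nu> B" by simp
qed

lemma haar_measure_eqI:
  assumes "abelian_group_shift G" "haar_probability G \<mu>"
  shows "\<mu> = haar_measure G"
  unfolding haar_measure_def
  using assms by (intro the_equality[symmetric]) (auto intro: haar_probability_unique)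

section \<open>Ergodic theory\<close>

definition preserves_measure :: "'x measure \<Rightarrow> ('x \<Rightarrow> 'x) \<Rightarrow> bool" where
  "preserves_measure M T \<longleftrightarrow> T \<in> measurable M M \<and>
     (\<forall>B\<in>sets M. emeasure M (T -` B \<inter> space M) = emeasure M B)"

definition ergodic :: "'x measure \<Rightarrow> ('x \<Rightarrow> 'x) \<Rightarrow> bool" where
  "ergodic M T \<longleftrightarrow> preserves_measure M T \<and>
     (\<forall>B\<in>sets M. T -` B \<inter> space M = B \<longrightarrow> measure M B = 0 \<or> measure M B = 1)"

definition totally_ergodic :: "'x measure \<Rightarrow> ('x \<Rightarrow> 'x) \<Rightarrow> bool" where
  "totally_ergodic M T \<longleftrightarrow> (\<forall>n\<ge>1. ergodic M (T ^^ n))"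

definition finite_measurable_partition :: "'x measure \<Rightarrow> 'x set set \<Rightarrow> bool" where
  "finite_measurable_partition M P \<longleftrightarrow> finite P \<and> P \<subseteq> sets M \<and> partition_on (space M) P"

definition partition_entropy :: "'x measure \<Rightarrow> 'x set set \<Rightarrow> real" where
  "partition_entropy M P = - (\<Sum>A\<in>P. measure M A * ln (measure M A))"

text \<open>Empty cells are dropped, as required by \<^const>\<open>partition_on\<close>.\<close>

definition pullback_partition :: "'x measure \<Rightarrow> ('x \<Rightarrow> 'x) \<Rightarrow> 'x set set \<Rightarrow> 'x set set" where
  "pullback_partition M T P = (\<lambda>A. T -` A \<inter> space M) ` P - {{}}"

definition iterated_join :: "'x measure \<Rightarrow> ('x \<Rightarrow> 'x) \<Rightarrow> 'x set set \<Rightarrow> nat \<Rightarrow> 'x set set" where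
  "iterated_join M T P n = common_refinement ((\<lambda>i. pullback_partition M (T ^^ i) P) ` {..<n})"

definition entropy_wrt_partition :: "'x measure \<Rightarrow> ('x \<Rightarrow> 'x) \<Rightarrow> 'x set set \<Rightarrow> real" where
  "entropy_wrt_partition M T P = lim (\<lambda>n. partition_entropy M (iterated_join M T P n) / real n)"

definition ks_entropy :: "'x measure \<Rightarrow> ('x \<Rightarrow> 'x) \<Rightarrow> ereal" where
  "ks_entropy M T = (SUP P \<in> Collect (finite_measurable_partition M). ereal (entropy_wrt_partition M T P))"

end

theory Submission
  imports Defs
begin

text \<open>A translate of \<open>\<mu>\<close> by \<open>d \<in> Ker F\<close> is ergodic for the power of the shift that fixes \<open>d\<close> (the kernel
  is finite), hence equal to \<open>\<mu>\<close> or singular to it. The \<open>d\<close> in the former case form a shift-invariant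
  subgroup of \<open>Ker F\<close>, which is therefore trivial or everything. If it is trivial, \<open>F\<close> is injective on a
  set of full measure; then a word \<open>x\<^bsub>[0,s-r)\<^esub>\<close> is asymptotically determined by long words of \<open>F x\<close>, the
  entropy of words of length \<open>n\<close> is \<open>o(n)\<close>, and \<open>F\<close> has zero entropy. So \<open>\<mu>\<close> is invariant under
  \<open>Ker F\<close>. A \<open>Ker F\<close>-invariant measure is determined by its image under \<open>F\<close>; hence if \<open>F d\<close> stabilizes
  \<open>\<mu>\<close>, so does \<open>d\<close>, and \<open>\<mu>\<close> is invariant under the kernels of all iterates of \<open>F\<close>. Their union is
  dense by bipermutativity, so \<open>\<mu>\<close> is invariant under all translations.\<close>

subsection \<open>Topology of the full shift\<close>

text \<open>The power of the shift that fixes \<open>d\<close> depends on \<open>d\<close>, which is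
  why ergodicity of all powers is called upon. The group operation need not act letter by letter, so
  the structure of \<open>Ker F\<close> comes only from permutativity: an element is determined by
  \<open>s - r\<close> consecutive letters. Zero entropy in the injective case comes from two
  observations. First, if \<open>F\<close> is injective on a set of full measure, then the word of
  \<open>x\<close> on \<open>[0, s - r)\<close> is a function of \<open>F x\<close> there, and up to
  small measure a function of a finite window of \<open>F x\<close>; its conditional entropy given
  growing windows of \<open>F x\<close> tends to 0. By invariance under \<open>F\<close> and the
  shift, these conditional entropies are exactly the increments of the word entropy of
  \<open>x\<close>. Second, the neighborhood may lie anywhere in the integers, so the orbit of a
  cylinder partition under \<open>F\<close> need not be generating; the entropy of \<open>F\<close>
  is bounded instead by counting letters: \<open>n\<close> steps of \<open>F\<close> seen through a
  fixed window depend on only O(n) letters of \<open>x\<close>. In the other case the fibers of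
  \<open>F\<close> are cosets of the finite kernel, so a kernel-invariant measure spreads its image
  evenly over each fiber.\<close>

definition cyl :: "nat \<Rightarrow> (int \<Rightarrow> 'a) \<Rightarrow> (int \<Rightarrow> 'a) set" where
  "cyl n x = {y. \<forall>i\<in>{- int n..int n}. y i = x i}"

lemma cyl_refl [simp]: "x \<in> cyl n x"
  by (simp add: cyl_def)

lemma cyl_eq: "y \<in> cyl n x \<Longrightarrow> cyl n y = cyl n x"
  by (auto simp: cyl_def)

lemma cyl_mono: "m \<le> n \<Longrightarrow> cyl n x \<subseteq> cyl m x"
  by (force simp: cyl_def)

lemma cyl_inter: "cyl m x \<inter> cyl n x = cyl (max m n) x"
  by (force simp: cyl_def max_def)

lemma finite_range_cyl: "finite (range (cyl n :: (int \<Rightarrow> 'a::finite) \<Rightarrow> _))"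
proof -
  let ?W = "{- int n..int n}"
  have "cyl n x = {y. \<forall>i\<in>?W. y i = restrict x ?W i}" for x :: "int \<Rightarrow> 'a"
    by (auto simp: cyl_def)
  then have "range (cyl n :: (int \<Rightarrow> 'a) \<Rightarrow> _) \<subseteq> (\<lambda>w. {y. \<forall>i\<in>?W. y i = w i}) ` (PiE ?W (\<lambda>_. UNIV))"
    by (intro image_subsetI) (rule image_eqI, assumption, auto)
  then show ?thesis
    by (rule finite_subset) (intro finite_imageI finite_PiE; simp)
qed

lemma open_vimage_coord: "open {y :: int \<Rightarrow> 'a::discrete_topology. y i \<in> S}"
proof -
  have "open ((\<lambda>y :: int \<Rightarrow> 'a. y i) -` S)"
    by (intro open_vimage open_discrete continuous_on_product_coordinates)
  then show ?thesis by (simp add: vimage_def)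
qed

lemma open_cyl: "open (cyl n (x :: int \<Rightarrow> 'a::discrete_topology))"
proof -
  have "cyl n x = (\<Inter>i\<in>{- int n..int n}. {y. y i \<in> {x i}})"
    by (auto simp: cyl_def)
  then show ?thesis
    by (simp only:) (intro open_INT open_vimage_coord ballI finite_atLeastAtMost_int)
qed

lemma closed_cyl: "closed (cyl n (x :: int \<Rightarrow> 'a::discrete_topology))"
proof -
  have "- cyl n x = (\<Union>i\<in>{- int n..int n}. {y. y i \<in> - {x i}})"
    by (auto simp: cyl_def)
  then show ?thesis
    by (simp only: closed_def) (intro open_UN open_vimage_coord ballI)
qed

lemma open_contains_cyl:
  fixes x :: "int \<Rightarrow> 'a::alphabet"
  assumes "open U" "x \<in> U"
  obtains n where "cyl n x \<subseteq> U"
proof -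
  have "openin (product_topology (\<lambda>i::int. euclidean :: 'a topology) UNIV) U"
    using assms(1) by (simp add: open_fun_def)
  from product_topology_open_contains_basis[OF this assms(2)]
  obtain X where X: "x \<in> (\<Pi>\<^sub>E i\<in>UNIV. X i)" "finite {i. X i \<noteq> topspace (euclidean :: 'a topology)}"
    "(\<Pi>\<^sub>E i\<in>UNIV. X i) \<subseteq> U"
    by blast
  \<comment> \<open>The sum of the absolute values of the constrained positions bounds each of them,
    even when there are none.\<close>
  define n where "n = (\<Sum>i\<in>{i. X i \<noteq> UNIV}. nat \<bar>i\<bar>)"
  have n: "i \<in> {- int n..int n}" if "X i \<noteq> UNIV" for i
  proof -
    have "nat \<bar>i\<bar> \<le> n"
      unfolding n_def
      by (rule member_le_sum[of i "{i. X i \<noteq> UNIV}" "\<lambda>i. nat \<bar>i\<bar>"]) (use that X(2) in simp_all)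
    then show ?thesis by auto
  qed
  have "cyl n x \<subseteq> (\<Pi>\<^sub>E i\<in>UNIV. X i)"
  proof
    fix y assume y: "y \<in> cyl n x"
    have "y i \<in> X i" for i
    proof (cases "X i = UNIV")
      case False
      then have "y i = x i" using y n[OF False] by (simp add: cyl_def)
      moreover have "x i \<in> X i" using X(1) by (rule PiE_mem) simp
      ultimately show ?thesis by simp
    qed simp
    then show "y \<in> (\<Pi>\<^sub>E i\<in>UNIV. X i)" by (simp add: PiE_UNIV_domain)
  qed
  then have "cyl n x \<subseteq> U" using X(3) by (rule subset_trans)
  then show thesis by (rule that)
qed

lemma compact_full_shift: "compact (UNIV :: (int \<Rightarrow> 'a::alphabet) set)"
proof -
  have "compact_space (euclidean :: 'a topology)"
    by (simp add: compact_space_def finite_imp_compact)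
  then have "compact_space (product_topology (\<lambda>i::int. euclidean :: 'a topology) UNIV)"
    unfolding compact_space_product_topology by blast
  then show ?thesis
    unfolding euclidean_product_topology compact_space_def by simp
qed

text \<open>A product of discrete spaces is Hausdorff. The purpose is that continuous images of
  closed sets are closed, hence Borel.\<close>

lemma compact_imp_closed_full_shift:
  assumes "compact (S :: (int \<Rightarrow> 'a::alphabet) set)"
  shows "closed S"
proof -
  have "Hausdorff_space (euclidean :: 'a topology)"
    unfolding Hausdorff_space_def
  proof (intro allI impI)
    fix x y :: 'a assume "x \<in> topspace euclidean \<and> y \<in> topspace euclidean \<and> x \<noteq> y"
    then show "\<exists>U V. openin euclidean U \<and> openin euclidean V \<and> x \<in> U \<and> y \<in> V \<and> disjnt U V"
      by (intro exI[of _ "{x}"] exI[of _ "{y}"]) (simp add: open_discrete disjnt_def)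
  qed
  then have "Hausdorff_space (euclidean :: (int \<Rightarrow> 'a) topology)"
    unfolding euclidean_product_topology[symmetric] Hausdorff_space_product_topology by blast
  then show ?thesis
    using compactin_imp_closedin[of euclidean S] assms by simp
qed

lemma closed_imp_compact_full_shift: "closed S \<Longrightarrow> compact (S :: (int \<Rightarrow> 'a::alphabet) set)"
  using compact_Int_closed[OF compact_full_shift, of S] by simp

lemma countable_cyls: "countable (\<Union>n\<in>{m..}. range (cyl n :: (int \<Rightarrow> 'a::finite) \<Rightarrow> _))"
  by (intro countable_UN countable_finite finite_range_cyl countableI_type)

text \<open>Large cylinders suffice, so that maps need only be understood on long words.\<close>

lemma borel_eq_sigma_cyl:
  "(borel :: (int \<Rightarrow> 'a::alphabet) measure) = sigma UNIV (\<Union>n\<in>{m..}. range (cyl n))"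
proof (rule borel_eq_countable_basis)
  show "countable (\<Union>n\<in>{m..}. range (cyl n :: (int \<Rightarrow> 'a) \<Rightarrow> _))" by (rule countable_cyls)
  show "topological_basis (\<Union>n\<in>{m..}. range (cyl n :: (int \<Rightarrow> 'a) \<Rightarrow> _))"
  proof (rule topological_basisI)
    fix U :: "(int \<Rightarrow> 'a) set" and x assume "open U" "x \<in> U"
    then obtain n where "cyl n x \<subseteq> U" by (rule open_contains_cyl)
    then have "cyl (max m n) x \<subseteq> U" using cyl_mono[of n "max m n" x] by simp
    moreover have "cyl (max m n) x \<in> (\<Union>n\<in>{m..}. range (cyl n))"
      by (rule UN_I[of "max m n"]) auto
    ultimately show "\<exists>B'\<in>\<Union>n\<in>{m..}. range (cyl n). x \<in> B' \<and> B' \<subseteq> U"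
      by (intro bexI[of _ "cyl (max m n) x"]) auto
  qed (auto simp: open_cyl)
qed

lemma sets_borel_cyl:
  "sets (borel :: (int \<Rightarrow> 'a::alphabet) measure) = sigma_sets UNIV (\<Union>n\<in>{m..}. range (cyl n))"
  by (simp add: borel_eq_sigma_cyl[of m])

lemma cyl_in_borel [measurable]: "cyl n (x :: int \<Rightarrow> 'a::alphabet) \<in> sets borel"
  by (simp add: open_cyl)

text \<open>Two cylinders that meet are nested, so with the empty set added they form a generator
  stable under intersection. The lower bound \<open>m\<close> allows a restriction to cylinders on
  which \<open>F\<close> is injective.\<close>

lemma measure_eqI_cyl:
  fixes \<mu> \<nu> :: "(int \<Rightarrow> 'a::alphabet) measure"
  assumes sets: "sets \<mu> = sets borel" "sets \<nu> = sets borel" and "finite_measure \<mu>"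
    and eq: "\<And>n x. n \<ge> m \<Longrightarrow> emeasure \<mu> (cyl n x) = emeasure \<nu> (cyl n x)"
  shows "\<mu> = \<nu>"
proof (rule measure_eqI_generator_eq_countable)
  interpret finite_measure \<mu> by fact
  let ?E = "insert {} (\<Union>n\<in>{m..}. range (cyl n :: (int \<Rightarrow> 'a) \<Rightarrow> _))"
  show "Int_stable ?E"
  proof (rule Int_stableI)
    fix A B assume A: "A \<in> ?E" and B: "B \<in> ?E"
    show "A \<inter> B \<in> ?E"
    proof (cases "A \<inter> B = {}")
      case False
      then obtain z j k where "z \<in> A" "z \<in> B" "j \<ge> m" "k \<ge> m"
        and "A \<in> range (cyl j)" "B \<in> range (cyl k)"
        using A B by auto
      then have "A = cyl j z" "B = cyl k z" using cyl_eq by blast+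
      then have "A \<inter> B = cyl (max j k) z" using cyl_inter by blast
      with \<open>j \<ge> m\<close> show ?thesis by (intro insertI2, intro UN_I[of "max j k"]) auto
    qed simp
  qed
  show "emeasure \<mu> X = emeasure \<nu> X" if "X \<in> ?E" for X using that eq by auto
  show "?E \<subseteq> Pow UNIV" by simp
  have "sigma_sets UNIV ?E = sigma_sets UNIV (\<Union>n\<in>{m..}. range (cyl n :: (int \<Rightarrow> 'a) \<Rightarrow> _))"
    by (intro antisym sigma_sets_mono) (auto intro: sigma_sets.Empty)
  then show "sets \<mu> = sigma_sets UNIV ?E" "sets \<nu> = sigma_sets UNIV ?E"
    using sets sets_borel_cyl[of m, where 'a='a] by auto
  show "countable (range (cyl m :: (int \<Rightarrow> 'a) \<Rightarrow> _))"
    by (intro countable_finite finite_range_cyl)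
  show "range (cyl m) \<subseteq> ?E" by auto
  show "\<Union>(range (cyl m)) = (UNIV :: (int \<Rightarrow> 'a) set)" using cyl_refl by blast
  show "emeasure \<mu> a \<noteq> \<infinity>" if "a \<in> range (cyl m)" for a using emeasure_finite by auto
qed

subsection \<open>Approximation of finite-valued functions\<close>

text \<open>Cylinders are clopen and approximate themselves; the sets with such approximations are
  closed under complement and countable union.\<close>

lemma borel_regular:
  fixes \<mu> :: "(int \<Rightarrow> 'a::alphabet) measure"
  assumes "finite_measure \<mu>" and s: "sets \<mu> = sets borel" and "B \<in> sets borel" "0 < e"
  shows "\<exists>K U. closed K \<and> open U \<and> K \<subseteq> B \<and> B \<subseteq> U \<and> measure \<mu> (U - K) < e"
proof -
  interpret finite_measure \<mu> by fact
  have [measurable]: "closed K \<Longrightarrow> K \<in> sets \<mu>" "open K \<Longrightarrow> K \<in> sets \<mu>" for K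
    using s by auto
  have "B \<in> sigma_sets UNIV (\<Union>n\<in>{0..}. range (cyl n))"
    using assms(3) sets_borel_cyl[of 0, where 'a='a] by simp
  then show ?thesis using \<open>0 < e\<close>
  proof (induction arbitrary: e rule: sigma_sets.induct)
    case (Basic A)
    then have "closed A" "open A" by (auto simp: open_cyl closed_cyl)
    with Basic show ?case by (intro exI[of _ A]) simp
  next
    case Empty
    then show ?case by (intro exI[of _ "{}"]) simp
  next
    case (Compl A)
    then obtain K U where "closed K" "open U" "K \<subseteq> A" "A \<subseteq> U" "measure \<mu> (U - K) < e"
      using Compl.IH[OF Compl.prems] by (elim exE conjE)
    moreover have "(UNIV - K) - (UNIV - U) = U - K" by blast
    ultimately show ?case
      by (intro exI[of _ "UNIV - U"] exI[of _ "UNIV - K"] conjI Diff_mono subset_refl open_Diff closed_Diff)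
        simp_all
  next
    case (Union A)
    \<comment> \<open>The errors \<open>d i\<close> add up to \<open>e / 2\<close>; the other half
      pays for replacing the infinite union of closed sets by a finite one.\<close>
    define d where "d i = e / 2 * (1/2) ^ Suc i" for i :: nat
    have "\<exists>K U. closed K \<and> open U \<and> K \<subseteq> A i \<and> A i \<subseteq> U \<and> measure \<mu> (U - K) < d i" for i
      using Union.IH[of "d i" i] Union.prems by (simp add: d_def)
    then obtain K U where KU: "\<And>i. closed (K i)" "\<And>i. open (U i)" "\<And>i. K i \<subseteq> A i"
      "\<And>i. A i \<subseteq> U i" "\<And>i. measure \<mu> (U i - K i) < d i"
      by metis
    have d: "d sums (e / 2)"
      unfolding d_def using sums_mult[OF power_half_series, of "e / 2"] by simp
    have [measurable]: "K i \<in> sets \<mu>" "U i \<in> sets \<mu>" for i using KU by auto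
    have "(\<lambda>n. measure \<mu> (\<Union>i<n. K i)) \<longlonglongrightarrow> measure \<mu> (\<Union>n. \<Union>i<n. K i)"
    proof (rule finite_Lim_measure_incseq)
      show "incseq (\<lambda>n. \<Union>i<n. K i)" by (intro monoI UN_mono) auto
    qed auto
    moreover have "(\<Union>n. \<Union>i<n. K i) = (\<Union>i. K i)" by auto
    ultimately have "\<forall>\<^sub>F n in sequentially. measure \<mu> (\<Union>i. K i) - e / 2 < measure \<mu> (\<Union>i<n. K i)"
      using order_tendstoD(1) Union.prems by fastforce
    then obtain n where n: "measure \<mu> (\<Union>i. K i) - e / 2 < measure \<mu> (\<Union>i<n. K i)"
      by (meson eventually_happens sequentially_bot)
    have sm: "summable (\<lambda>i. measure \<mu> (U i - K i))"
      by (rule summable_comparison_test'[OF sums_summable[OF d], of 0])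
        (use less_imp_le[OF KU(5)] in simp)
    \<comment> \<open>Only a finite union of the inner sets is guaranteed to be closed, whereas the
      outer union stays open.\<close>
    let ?K = "\<Union>i<n. K i" and ?U = "\<Union>i. U i"
    have "measure \<mu> (?U - ?K) \<le> measure \<mu> ((\<Union>i. U i - K i) \<union> ((\<Union>i. K i) - ?K))"
      by (rule finite_measure_mono) auto
    also have "\<dots> \<le> measure \<mu> (\<Union>i. U i - K i) + measure \<mu> ((\<Union>i. K i) - ?K)"
      by (rule measure_Un_le) auto
    also have "measure \<mu> (\<Union>i. U i - K i) \<le> (\<Sum>i. measure \<mu> (U i - K i))"
      using sm by (intro finite_measure_subadditive_countably) auto
    also have "\<dots> \<le> (\<Sum>i. d i)"
      using sm sums_summable[OF d] less_imp_le[OF KU(5)] by (intro suminf_le) auto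
    also have "\<dots> = e / 2"
      using sums_unique[OF d] by simp
    also have "measure \<mu> ((\<Union>i. K i) - ?K) = measure \<mu> (\<Union>i. K i) - measure \<mu> ?K"
      by (rule finite_measure_Diff) auto
    also have "\<dots> < e / 2" using n by simp
    finally have "measure \<mu> (?U - ?K) < e" by simp
    moreover have "?K \<subseteq> \<Union>(range A)" "\<Union>(range A) \<subseteq> ?U" using KU(3,4) by fast+
    moreover have "closed ?K" "open ?U" using KU(1,2) by auto
    ultimately show ?case by blast
  qed
qed

text \<open>Each point of \<open>K\<close> has a cylinder that misses \<open>L\<close>; by
  compactness finitely many of them cover \<open>K\<close>, and their largest radius serves
  everywhere.\<close>

lemma separate_closed_by_cyl:
  fixes K L :: "(int \<Rightarrow> 'a::alphabet) set"
  assumes "closed K" "closed L" "K \<inter> L = {}"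
  shows "\<exists>n. \<forall>x\<in>K. \<forall>y\<in>L. y \<notin> cyl n x"
proof -
  have "\<exists>n. cyl n x \<subseteq> - L" if "x \<in> K" for x
  proof -
    have "open (- L)" "x \<in> - L" using assms that by auto
    then show ?thesis by (rule open_contains_cyl) blast
  qed
  then obtain f where f: "\<And>x. x \<in> K \<Longrightarrow> cyl (f x) x \<subseteq> - L" by metis
  have "K \<subseteq> (\<Union>x\<in>K. cyl (f x) x)" by auto
  then obtain C where C: "C \<subseteq> K" "finite C" "K \<subseteq> (\<Union>x\<in>C. cyl (f x) x)"
    by (rule compactE_image[OF closed_imp_compact_full_shift[OF assms(1)] open_cyl])
  \<comment> \<open>The 0 covers the case of an empty subcover.\<close>
  define n where "n = Max (insert 0 (f ` C))"
  have "y \<notin> cyl n x" if x: "x \<in> K" and y: "y \<in> L" for x y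
  proof
    assume yn: "y \<in> cyl n x"
    obtain z where z: "z \<in> C" "x \<in> cyl (f z) z" using C x by auto
    have "f z \<le> n" unfolding n_def using C z by (intro Max_ge) auto
    then have "y \<in> cyl (f z) x" using yn cyl_mono by blast
    then have "y \<in> cyl (f z) z" using cyl_eq[OF z(2)] by simp
    then show False using f C z y by blast
  qed
  then show ?thesis by blast
qed

text \<open>A statement of Lusin type: what is determined by all of \<open>Y x\<close> is determined
  by a finite window of it, off a set of small measure. Each level set of \<open>X\<close> in
  \<open>E\<close> is shrunk to a compact set; the images under \<open>Y\<close> of these sets are
  compact and disjoint, so a finite window tells them apart.\<close>

lemma approx_factor:
  fixes \<mu> :: "(int \<Rightarrow> 'a::alphabet) measure" and Y :: "(int \<Rightarrow> 'a) \<Rightarrow> (int \<Rightarrow> 'a)"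
  assumes "prob_space \<mu>" and s: "sets \<mu> = sets borel"
    and X: "simple_function \<mu> X" and Y: "continuous_on UNIV Y"
    and E: "E \<in> sets \<mu>" "measure \<mu> E = 1"
    and inj: "\<And>x y. x \<in> E \<Longrightarrow> y \<in> E \<Longrightarrow> Y x = Y y \<Longrightarrow> X x = X y" and "0 < e"
  shows "\<exists>n A. A \<in> sets \<mu> \<and> measure \<mu> A > 1 - e \<and>
    (\<forall>x\<in>A. \<forall>y\<in>A. Y y \<in> cyl n (Y x) \<longrightarrow> X x = X y)"
proof -
  interpret prob_space \<mu> by fact
  have sp: "space \<mu> = UNIV" using sets_eq_imp_space_eq[OF s] by simp
  define R where "R = range X"
  have R: "finite R" "R \<noteq> {}" using X by (auto simp: R_def simple_function_def sp)
  define B where "B c = X -` {c} \<inter> E" for c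
  have B: "B c \<in> sets \<mu>" for c
    unfolding B_def using simple_functionD(2)[OF X, of "{c}"] E by (auto simp: sp)
  define d where "d = e / real (card R)"
  have "0 < d" using \<open>0 < e\<close> R by (simp add: d_def card_gt_0_iff)
  have "\<exists>K. closed K \<and> K \<subseteq> B c \<and> measure \<mu> (B c - K) < d" for c
  proof -
    obtain K U where K: "closed K" "open U" "K \<subseteq> B c" "B c \<subseteq> U" "measure \<mu> (U - K) < d"
      using borel_regular[OF finite_measure_axioms s _ \<open>0 < d\<close>, of "B c"] B s by auto
    moreover have "measure \<mu> (B c - K) \<le> measure \<mu> (U - K)"
      by (rule finite_measure_mono) (use K s in auto)
    ultimately show ?thesis by (intro exI[of _ K]) auto
  qed
  then obtain K where K: "\<And>c. closed (K c)" "\<And>c. K c \<subseteq> B c" "\<And>c. measure \<mu> (B c - K c) < d"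
    by metis
  have Km: "K c \<in> sets \<mu>" for c using K(1) s by auto
  have clY: "closed (Y ` K c)" for c
    using Y K(1) closed_imp_compact_full_shift compact_continuous_image compact_imp_closed_full_shift
    by (metis continuous_on_subset subset_UNIV)
  have "\<exists>n. \<forall>x\<in>Y ` K c. \<forall>y\<in>Y ` K c'. y \<notin> cyl n x" if "c \<noteq> c'" for c c'
  proof (rule separate_closed_by_cyl[OF clY clY])
    show "Y ` K c \<inter> Y ` K c' = {}"
      using K(2) inj that unfolding B_def by blast
  qed
  then obtain N where N: "\<And>c c' x y. c \<noteq> c' \<Longrightarrow> x \<in> K c \<Longrightarrow> y \<in> K c' \<Longrightarrow> Y y \<notin> cyl (N c c') (Y x)"
    by (metis imageI)
  define n where "n = Max ((\<lambda>(c, c'). N c c') ` (R \<times> R))"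
  have n: "N c c' \<le> n" if "c \<in> R" "c' \<in> R" for c c'
    unfolding n_def using R that by (intro Max_ge) auto
  define A where "A = (\<Union>c\<in>R. K c)"
  have Am: "A \<in> sets \<mu>" unfolding A_def using R Km by auto
  have "measure \<mu> (E - A) \<le> measure \<mu> (\<Union>c\<in>R. B c - K c)"
  proof (rule finite_measure_mono)
    show "E - A \<subseteq> (\<Union>c\<in>R. B c - K c)" by (auto simp: A_def B_def R_def)
    show "(\<Union>c\<in>R. B c - K c) \<in> sets \<mu>"
      using R B Km by (intro sets.finite_UN sets.Diff)
  qed
  also have "\<dots> \<le> (\<Sum>c\<in>R. measure \<mu> (B c - K c))"
    using R B Km by (intro finite_measure_subadditive_finite) auto
  also have "\<dots> < (\<Sum>c\<in>R. d)"
    using R K(3) by (intro sum_strict_mono) auto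
  also have "\<dots> = e" using R by (simp add: d_def)
  finally have lt: "measure \<mu> (E - A) < e" .
  have "A \<subseteq> E" using K(2) by (auto simp: A_def B_def)
  then have "measure \<mu> (E - A) = 1 - measure \<mu> A"
    using E Am finite_measure_Diff by simp
  with lt have "measure \<mu> A > 1 - e" by simp
  moreover have "X x = X y" if x: "x \<in> A" and y: "y \<in> A" and yx: "Y y \<in> cyl n (Y x)" for x y
  proof (rule ccontr)
    assume ne: "X x \<noteq> X y"
    obtain c c' where c: "c \<in> R" "x \<in> K c" "c' \<in> R" "y \<in> K c'"
      using x y unfolding A_def by blast
    then have "X x = c" "X y = c'" using K(2) unfolding B_def by blast+
    with N[of c c' x y] ne c have "Y y \<notin> cyl (N c c') (Y x)" by simp
    then show False using yx cyl_mono[OF n[OF c(1,3)]] by blast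
  qed
  ultimately show ?thesis using Am by blast
qed

subsection \<open>Entropy of finite-valued functions\<close>

text \<open>Defined through the partition into level sets, so that only the points identified by
  \<open>X\<close> matter and functions with different value types compare directly.\<close>

definition ent :: "'x measure \<Rightarrow> ('x \<Rightarrow> 'c) \<Rightarrow> real" where
  "ent M X = partition_entropy M ((\<lambda>x. {y \<in> space M. X y = X x}) ` space M)"

text \<open>The chain rule taken as the definition of H(X | Y).\<close>

definition cond_ent :: "'x measure \<Rightarrow> ('x \<Rightarrow> 'c) \<Rightarrow> ('x \<Rightarrow> 'd) \<Rightarrow> real" where
  "cond_ent M X Y = ent M (\<lambda>x. (X x, Y x)) - ent M Y"

lemma ent_cong:
  assumes "\<And>x y. x \<in> space M \<Longrightarrow> y \<in> space M \<Longrightarrow> X x = X y \<longleftrightarrow> Y x = Y y"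
  shows "ent M X = ent M Y"
proof -
  have "{y \<in> space M. X y = X x} = {y \<in> space M. Y y = Y x}" if "x \<in> space M" for x
    using assms that by blast
  then have "(\<lambda>x. {y \<in> space M. X y = X x}) ` space M = (\<lambda>x. {y \<in> space M. Y y = Y x}) ` space M"
    by (intro image_cong refl)
  then show ?thesis by (simp add: ent_def)
qed

lemma ent_eq_sum:
  assumes "finite S" "X ` space M \<subseteq> S"
  shows "ent M X = - (\<Sum>c\<in>S. measure M {x \<in> space M. X x = c} * ln (measure M {x \<in> space M. X x = c}))"
proof -
  let ?A = "\<lambda>c. {x \<in> space M. X x = c}"
  have "inj_on ?A (X ` space M)" by (rule inj_onI) auto
  then have "ent M X = - (\<Sum>c\<in>X ` space M. measure M (?A c) * ln (measure M (?A c)))"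
    using sum.reindex[of ?A "X ` space M" "\<lambda>A. measure M A * ln (measure M A)"]
    by (simp add: ent_def partition_entropy_def image_image)
  also have "(\<Sum>c\<in>X ` space M. measure M (?A c) * ln (measure M (?A c))) =
      (\<Sum>c\<in>S. measure M (?A c) * ln (measure M (?A c)))"
  proof (rule sum.mono_neutral_left[OF assms], rule ballI)
    fix c assume "c \<in> S - X ` space M"
    then have "?A c = {}" by auto
    then show "measure M (?A c) * ln (measure M (?A c)) = 0" by (simp only: measure_empty mult_zero_left)
  qed
  finally show ?thesis .
qed

text \<open>Nonnegativity of conditional mutual information, proved termwise from
  \<open>ln t \<le> t - 1\<close>; the correction terms cancel in the sum.\<close>

lemma sum_strong_subadditivity:
  fixes p :: "'a \<Rightarrow> 'b \<Rightarrow> 'c \<Rightarrow> real"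
  assumes fin: "finite A" "finite B" "finite C" and nn: "\<And>a b c. 0 \<le> p a b c"
  defines "pac \<equiv> \<lambda>a c. \<Sum>b\<in>B. p a b c" and "pbc \<equiv> \<lambda>b c. \<Sum>a\<in>A. p a b c"
    and "pc \<equiv> \<lambda>c. \<Sum>a\<in>A. \<Sum>b\<in>B. p a b c"
  shows "(\<Sum>a\<in>A. \<Sum>c\<in>C. pac a c * ln (pac a c)) + (\<Sum>b\<in>B. \<Sum>c\<in>C. pbc b c * ln (pbc b c))
     \<le> (\<Sum>a\<in>A. \<Sum>b\<in>B. \<Sum>c\<in>C. p a b c * ln (p a b c)) + (\<Sum>c\<in>C. pc c * ln (pc c))"
proof -
  have pac: "p a b c \<le> pac a c" if "b \<in> B" for a b c
    unfolding pac_def by (rule member_le_sum[OF that]) (use fin nn in auto)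
  have pbc: "p a b c \<le> pbc b c" if "a \<in> A" for a b c
    unfolding pbc_def by (rule member_le_sum[OF that]) (use fin nn in auto)
  have pc_pac: "pc c = (\<Sum>a\<in>A. pac a c)" for c by (simp add: pc_def pac_def)
  have pc_pbc: "pc c = (\<Sum>b\<in>B. pbc b c)" for c
    unfolding pc_def pbc_def by (rule sum.swap)
  have nn': "0 \<le> pac a c" "0 \<le> pbc b c" "0 \<le> pc c" for a b c
    by (auto simp: pac_def pbc_def pc_def intro!: sum_nonneg nn)
  have pc: "p a b c \<le> pc c" if "a \<in> A" "b \<in> B" for a b c
    using pac[OF that(2), of a c] member_le_sum[OF that(1), of "\<lambda>a. pac a c"] fin nn'
    by (simp add: pc_pac)
  \<comment> \<open>The inequality is applied to \<open>t = pac * pbc / (p * pc)\<close>. Terms with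
    \<open>p a b c = 0\<close> contribute only a nonnegative correction on the right.\<close>
  have term_le: "p a b c * ln (pac a c) + p a b c * ln (pbc b c)
      \<le> p a b c * ln (p a b c) + p a b c * ln (pc c) + (pac a c * pbc b c / pc c - p a b c)"
    if ab: "a \<in> A" "b \<in> B" for a b c
  proof (cases "p a b c = 0")
    case True
    then show ?thesis using nn' by simp
  next
    case False
    then have p: "0 < p a b c" using nn[of a b c] by simp
    then have pos: "0 < pac a c" "0 < pbc b c" "0 < pc c"
      using pac[OF ab(2), of a c] pbc[OF ab(1), of b c] pc[OF ab, of c] by simp_all
    let ?t = "pac a c * pbc b c / (p a b c * pc c)"
    have "p a b c * ln ?t \<le> p a b c * (?t - 1)"
      using p pos by (intro mult_left_mono ln_le_minus_one) auto
    moreover have "ln ?t = ln (pac a c) + ln (pbc b c) - (ln (p a b c) + ln (pc c))"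
      using p pos by (simp add: ln_div ln_mult)
    moreover have "p a b c * (?t - 1) = pac a c * pbc b c / pc c - p a b c"
      using p pos by (simp add: field_simps)
    ultimately have "p a b c * (ln (pac a c) + ln (pbc b c) - (ln (p a b c) + ln (pc c)))
        \<le> pac a c * pbc b c / pc c - p a b c"
      by simp
    then show ?thesis by (simp only: distrib_left right_diff_distrib)
  qed
  have "(\<Sum>a\<in>A. \<Sum>c\<in>C. pac a c * ln (pac a c)) = (\<Sum>a\<in>A. \<Sum>b\<in>B. \<Sum>c\<in>C. p a b c * ln (pac a c))"
    by (rule sum.cong[OF refl], subst sum.swap) (simp add: pac_def sum_distrib_right)
  moreover have "(\<Sum>b\<in>B. \<Sum>c\<in>C. pbc b c * ln (pbc b c)) = (\<Sum>a\<in>A. \<Sum>b\<in>B. \<Sum>c\<in>C. p a b c * ln (pbc b c))"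
  proof -
    have "(\<Sum>a\<in>A. \<Sum>b\<in>B. \<Sum>c\<in>C. p a b c * ln (pbc b c)) = (\<Sum>b\<in>B. \<Sum>a\<in>A. \<Sum>c\<in>C. p a b c * ln (pbc b c))"
      by (rule sum.swap)
    also have "\<dots> = (\<Sum>b\<in>B. \<Sum>c\<in>C. \<Sum>a\<in>A. p a b c * ln (pbc b c))"
      by (intro sum.cong refl sum.swap)
    finally show ?thesis by (simp add: pbc_def sum_distrib_right)
  qed
  moreover have swap3: "(\<Sum>a\<in>A. \<Sum>b\<in>B. \<Sum>c\<in>C. f a b c) = (\<Sum>c\<in>C. \<Sum>a\<in>A. \<Sum>b\<in>B. f a b c)"
    for f :: "'a \<Rightarrow> 'b \<Rightarrow> 'c \<Rightarrow> real"
  proof -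
    have "(\<Sum>a\<in>A. \<Sum>b\<in>B. \<Sum>c\<in>C. f a b c) = (\<Sum>a\<in>A. \<Sum>c\<in>C. \<Sum>b\<in>B. f a b c)"
      by (intro sum.cong refl sum.swap)
    also have "\<dots> = (\<Sum>c\<in>C. \<Sum>a\<in>A. \<Sum>b\<in>B. f a b c)" by (rule sum.swap)
    finally show ?thesis .
  qed
  moreover have "(\<Sum>c\<in>C. pc c * ln (pc c)) = (\<Sum>a\<in>A. \<Sum>b\<in>B. \<Sum>c\<in>C. p a b c * ln (pc c))"
    unfolding swap3 by (simp add: pc_def sum_distrib_right)
  \<comment> \<open>At fixed \<open>c\<close> the products factor into
    \<open>pc c * pc c / pc c = pc c\<close>, which also holds when \<open>pc c = 0\<close>.\<close>
  moreover have "(\<Sum>a\<in>A. \<Sum>b\<in>B. \<Sum>c\<in>C. pac a c * pbc b c / pc c - p a b c) = 0"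
  proof -
    have "(\<Sum>a\<in>A. \<Sum>b\<in>B. pac a c * pbc b c / pc c - p a b c) = 0" for c
    proof -
      have "(\<Sum>a\<in>A. \<Sum>b\<in>B. pac a c * pbc b c / pc c) = (\<Sum>a\<in>A. pac a c) * (\<Sum>b\<in>B. pbc b c) / pc c"
        by (simp only: sum_divide_distrib sum_product)
      also have "\<dots> = pc c"
        by (simp add: pc_pac[symmetric] pc_pbc[symmetric])
      finally show ?thesis by (simp add: sum_subtractf pc_def)
    qed
    then show ?thesis unfolding swap3 by simp
  qed
  moreover have "(\<Sum>a\<in>A. \<Sum>b\<in>B. \<Sum>c\<in>C. p a b c * ln (pac a c) + p a b c * ln (pbc b c)) \<le>
     (\<Sum>a\<in>A. \<Sum>b\<in>B. \<Sum>c\<in>C. p a b c * ln (p a b c) + p a b c * ln (pc c) + (pac a c * pbc b c / pc c - p a b c))"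
    by (intro sum_mono term_le)
  ultimately show ?thesis by (simp only: sum.distrib)
qed

context prob_space
begin

lemma simple_function_level_set:
  "simple_function M X \<Longrightarrow> {x \<in> space M. X x = c} \<in> events"
  using simple_functionD(2)[of M X "{c}"] by (simp add: vimage_def Int_def conj_commute)

lemma prob_eq_sum_fibers:
  assumes "simple_function M Y" "simple_function M X"
  shows "prob {x \<in> space M. X x = a} = (\<Sum>b\<in>Y ` space M. prob {x \<in> space M. X x = a \<and> Y x = b})"
proof -
  have "(\<lambda>b. {x \<in> space M. X x = a \<and> Y x = b}) ` (Y ` space M) \<subseteq> events"
    using simple_function_level_set[OF simple_function_Pair[OF assms(2,1)], of "(a, _)"] by auto
  moreover have "finite (Y ` space M)" using assms(1) by (simp add: simple_function_def)
  moreover have "disjoint_family_on (\<lambda>b. {x \<in> space M. X x = a \<and> Y x = b}) (Y ` space M)"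
    by (auto simp: disjoint_family_on_def)
  ultimately have "prob (\<Union>b\<in>Y ` space M. {x \<in> space M. X x = a \<and> Y x = b}) =
      (\<Sum>b\<in>Y ` space M. prob {x \<in> space M. X x = a \<and> Y x = b})"
    by (intro finite_measure_finite_Union)
  moreover have "(\<Union>b\<in>Y ` space M. {x \<in> space M. X x = a \<and> Y x = b}) = {x \<in> space M. X x = a}"
    by auto
  ultimately show ?thesis by simp
qed

text \<open>This is H(X | Y, Z) \<le> H(X | Z) with the conditional entropies written out;
  monotonicity of \<open>ent\<close> and of \<open>cond_ent\<close> are special cases.\<close>

lemma ent_strong_subadditive:
  assumes X: "simple_function M X" and Y: "simple_function M Y" and Z: "simple_function M Z"
  shows "ent M (\<lambda>x. (X x, Y x, Z x)) + ent M Z \<le> ent M (\<lambda>x. (X x, Z x)) + ent M (\<lambda>x. (Y x, Z x))"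
proof -
  let ?A = "X ` space M" and ?B = "Y ` space M" and ?C = "Z ` space M"
  let ?p = "\<lambda>a b c. prob {x \<in> space M. X x = a \<and> Y x = b \<and> Z x = c}"
  have fin: "finite ?A" "finite ?B" "finite ?C"
    using assms by (auto simp: simple_function_def)
  have ac: "prob {x \<in> space M. X x = a \<and> Z x = c} = (\<Sum>b\<in>?B. ?p a b c)" for a c
    using prob_eq_sum_fibers[OF Y simple_function_Pair[OF X Z], of "(a, c)"]
    by (simp add: conj_ac)
  have bc: "prob {x \<in> space M. Y x = b \<and> Z x = c} = (\<Sum>a\<in>?A. ?p a b c)" for b c
    using prob_eq_sum_fibers[OF X simple_function_Pair[OF Y Z], of "(b, c)"]
    by (simp add: conj_ac)
  have c: "prob {x \<in> space M. Z x = c} = (\<Sum>a\<in>?A. \<Sum>b\<in>?B. ?p a b c)" for c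
    using prob_eq_sum_fibers[OF X Z, of c] by (simp only: conj_commute[of "Z _ = c"] ac)
  have "ent M (\<lambda>x. (X x, Y x, Z x)) = - (\<Sum>a\<in>?A. \<Sum>b\<in>?B. \<Sum>c\<in>?C. ?p a b c * ln (?p a b c))"
    using fin by (subst ent_eq_sum[of "?A \<times> ?B \<times> ?C"]) (auto simp: sum.cartesian_product')
  moreover have "ent M Z = - (\<Sum>c\<in>?C. (\<Sum>a\<in>?A. \<Sum>b\<in>?B. ?p a b c) * ln (\<Sum>a\<in>?A. \<Sum>b\<in>?B. ?p a b c))"
    using fin by (subst ent_eq_sum[of ?C]) (auto simp: c)
  moreover have "ent M (\<lambda>x. (X x, Z x)) = - (\<Sum>a\<in>?A. \<Sum>c\<in>?C. (\<Sum>b\<in>?B. ?p a b c) * ln (\<Sum>b\<in>?B. ?p a b c))"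
    using fin by (subst ent_eq_sum[of "?A \<times> ?C"]) (auto simp: ac sum.cartesian_product')
  moreover have "ent M (\<lambda>x. (Y x, Z x)) = - (\<Sum>b\<in>?B. \<Sum>c\<in>?C. (\<Sum>a\<in>?A. ?p a b c) * ln (\<Sum>a\<in>?A. ?p a b c))"
    using fin by (subst ent_eq_sum[of "?B \<times> ?C"]) (auto simp: bc sum.cartesian_product')
  moreover note sum_strong_subadditivity[OF fin, of ?p]
  ultimately show ?thesis by simp
qed

lemma ent_mono:
  assumes X: "simple_function M X" and Y: "simple_function M Y"
    and det: "\<And>x y. x \<in> space M \<Longrightarrow> y \<in> space M \<Longrightarrow> X x = X y \<Longrightarrow> Y x = Y y"
  shows "ent M Y \<le> ent M X"
proof -
  \<comment> \<open>With \<open>X\<close> in both places and \<open>Y\<close> as the condition,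
    every joint entropy collapses to that of \<open>X\<close>.\<close>
  have "ent M (\<lambda>x. (X x, X x, Y x)) = ent M X" "ent M (\<lambda>x. (X x, Y x)) = ent M X"
    by (rule ent_cong, simp, blast intro: det)+
  with ent_strong_subadditive[OF X X Y] show ?thesis by simp
qed

lemma cond_ent_mono:
  assumes X: "simple_function M X" and Y: "simple_function M Y" and Z: "simple_function M Z"
    and det: "\<And>x y. x \<in> space M \<Longrightarrow> y \<in> space M \<Longrightarrow> Y x = Y y \<Longrightarrow> Z x = Z y"
  shows "cond_ent M X Y \<le> cond_ent M X Z"
proof -
  have "ent M (\<lambda>x. (X x, Y x, Z x)) = ent M (\<lambda>x. (X x, Y x))" "ent M (\<lambda>x. (Y x, Z x)) = ent M Y"
    by (rule ent_cong, simp, blast intro: det)+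
  with ent_strong_subadditive[OF X Y Z] show ?thesis by (simp add: cond_ent_def)
qed

lemma cond_ent_nonneg:
  assumes "simple_function M X" "simple_function M Y"
  shows "0 \<le> cond_ent M X Y"
  using ent_mono[OF simple_function_Pair[OF assms] assms(2)] by (simp add: cond_ent_def)

end

section \<open>Continuity of conditional entropy\<close>

lemma abs_mult_ln_le:
  fixes t :: real
  assumes "0 \<le> t" "t \<le> 1"
  shows "\<bar>t * ln t\<bar> \<le> 2 * sqrt t"
proof (cases "t = 0")
  case False
  then have t: "0 < t" "0 < sqrt t" using assms by simp_all
  \<comment> \<open>Passing to the square root before using \<open>ln u \<le> u - 1\<close> gains a
    factor that still tends to 0 with \<open>t\<close>.\<close>
  have "- ln t = 2 * ln (1 / sqrt t)" using t by (simp add: ln_div ln_sqrt)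
  also have "\<dots> \<le> 2 * (1 / sqrt t - 1)" using t by (intro mult_left_mono ln_le_minus_one) auto
  finally have "- ln t \<le> 2 * (1 / sqrt t)" by simp
  then have "t * (- ln t) \<le> t * (2 * (1 / sqrt t))" using t by (intro mult_left_mono) auto
  also have "\<dots> = 2 * (t / sqrt t)" by simp
  also have "\<dots> = 2 * sqrt t" using t by (simp add: real_div_sqrt)
  finally show ?thesis using assms t by (simp add: abs_mult)
qed simp

lemma continuous_on_mult_ln: "continuous_on {0..1} (\<lambda>t :: real. t * ln t)"
  unfolding continuous_on_def
proof
  fix t :: real assume t: "t \<in> {0..1}"
  show "((\<lambda>t. t * ln t) \<longlongrightarrow> t * ln t) (at t within {0..1})"
  proof (cases "t = 0")
    case True
    have "((\<lambda>t. 2 * sqrt t) \<longlongrightarrow> 2 * sqrt 0) (at 0 within {0..1})"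
      by (intro tendsto_mult tendsto_const tendsto_real_sqrt tendsto_ident_at)
    then have lim: "((\<lambda>t. 2 * sqrt t) \<longlongrightarrow> 0) (at (0::real) within {0..1})" by simp
    have "\<forall>\<^sub>F t in at (0::real) within {0..1}. norm (t * ln t) \<le> 2 * sqrt t"
      unfolding eventually_at_filter real_norm_def
      by (rule always_eventually) (use abs_mult_ln_le in fastforce)
    from Lim_null_comparison[OF this lim]
    have "((\<lambda>t. t * ln t) \<longlongrightarrow> 0) (at (0::real) within {0..1})" .
    then show ?thesis using True by simp
  next
    case False
    then show ?thesis by (intro tendsto_mult tendsto_ident_at tendsto_ln)
  qed
qed

context prob_space
begin

lemma prob_diff_le_of_agree:
  assumes "A \<in> events" "E \<in> events" "E' \<in> events" "E \<inter> A = E' \<inter> A"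
  shows "\<bar>prob E - prob E'\<bar> \<le> 1 - prob A"
proof -
  have le: "prob E \<le> prob E' + (1 - prob A)"
    if "E \<in> events" "E' \<in> events" "E \<inter> A = E' \<inter> A" for E E'
  proof -
    have "E \<subseteq> E' \<union> (space M - A)" using that sets.sets_into_space by blast
    then have "prob E \<le> prob (E' \<union> (space M - A))"
      using that assms(1) by (intro finite_measure_mono) auto
    also have "\<dots> \<le> prob E' + prob (space M - A)"
      using that assms(1) by (intro measure_Un_le) auto
    finally show ?thesis using prob_compl[OF assms(1)] by simp
  qed
  show ?thesis using le[OF assms(2-4)] le[OF assms(3,2) assms(4)[symmetric]] by linarith
qed

text \<open>Both entropies are finite sums of values of the uniformly continuous function
  \<open>t ln t\<close>, and every probability changes little when \<open>Z\<close> is replaced by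
  \<open>X\<close>, where the conditional entropy is 0. Confining the values of \<open>Z\<close> to
  those of \<open>X\<close> bounds the number of terms independently of \<open>Z\<close>.\<close>

lemma cond_ent_small:
  assumes X: "simple_function M X" and "0 < (d :: real)"
  shows "\<exists>e>0. \<forall>Z A. simple_function M Z \<longrightarrow> Z ` space M \<subseteq> X ` space M \<longrightarrow> A \<in> events \<longrightarrow>
    1 - e < prob A \<longrightarrow> (\<forall>x\<in>A. Z x = X x) \<longrightarrow> cond_ent M X Z < d"
proof -
  let ?S = "X ` space M"
  \<comment> \<open>The number of terms in the two sums, plus 1 to make the final bound
    \<open>(k - 1) * (d / k) < d\<close> strict.\<close>
  define k where "k = real (card (?S \<times> ?S)) + real (card ?S) + 1"
  have k: "0 < k" by (simp add: k_def add_nonneg_pos)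
  have fin: "finite ?S" using X by (simp add: simple_function_def)
  have "uniformly_continuous_on {0..1} (\<lambda>t :: real. t * ln t)"
    by (intro compact_uniformly_continuous continuous_on_mult_ln compact_Icc)
  moreover have "0 < d / k" using \<open>0 < d\<close> k by simp
  ultimately obtain e where e: "0 < e" "\<And>s t :: real. s \<in> {0..1} \<Longrightarrow> t \<in> {0..1} \<Longrightarrow>
      \<bar>s - t\<bar> < e \<Longrightarrow> \<bar>s * ln s - t * ln t\<bar> < d / k"
    unfolding uniformly_continuous_on_def dist_real_def by metis
  have close: "\<bar>prob E * ln (prob E) - prob E' * ln (prob E')\<bar> \<le> d / k"
    if "A \<in> events" "E \<in> events" "E' \<in> events" "E \<inter> A = E' \<inter> A" "1 - e < prob A" for A E E'
    using e(2)[of "prob E" "prob E'"] prob_diff_le_of_agree[OF that(1-4)] that(5) by simp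
  have "cond_ent M X Z < d" if Z: "simple_function M Z" "Z ` space M \<subseteq> ?S"
    and A: "A \<in> events" "1 - e < prob A" "\<forall>x\<in>A. Z x = X x" for Z A
  proof -
    let ?q = "\<lambda>W c. prob {x \<in> space M. W x = c} * ln (prob {x \<in> space M. W x = c})"
    have eq: "cond_ent M X W = (\<Sum>b\<in>?S. ?q W b) - (\<Sum>c\<in>?S \<times> ?S. ?q (\<lambda>x. (X x, W x)) c)"
      if "W ` space M \<subseteq> ?S" for W
    proof -
      have "(\<lambda>x. (X x, W x)) ` space M \<subseteq> ?S \<times> ?S" using that by auto
      then show ?thesis
        unfolding cond_ent_def using fin that
        by (subst ent_eq_sum[of "?S \<times> ?S"], simp, simp, subst ent_eq_sum[of ?S]) simp_all
    qed
    have "ent M (\<lambda>x. (X x, X x)) = ent M X" by (rule ent_cong) simp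
    then have zero: "cond_ent M X X = 0" by (simp add: cond_ent_def)
    have "\<bar>(\<Sum>b\<in>?S. ?q Z b) - (\<Sum>b\<in>?S. ?q X b)\<bar> \<le> (\<Sum>b\<in>?S. d / k)"
      unfolding sum_subtractf[symmetric]
    proof (intro order_trans[OF sum_abs] sum_mono close[OF A(1) _ _ _ A(2)])
      show "{x \<in> space M. Z x = b} \<inter> A = {x \<in> space M. X x = b} \<inter> A" for b using A(3) by auto
    qed (use simple_function_level_set X Z in auto)
    moreover have "\<bar>(\<Sum>c\<in>?S \<times> ?S. ?q (\<lambda>x. (X x, Z x)) c) - (\<Sum>c\<in>?S \<times> ?S. ?q (\<lambda>x. (X x, X x)) c)\<bar>
        \<le> (\<Sum>c\<in>?S \<times> ?S. d / k)"
      unfolding sum_subtractf[symmetric]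
    proof (intro order_trans[OF sum_abs] sum_mono close[OF A(1) _ _ _ A(2)])
      show "{x \<in> space M. (X x, Z x) = b} \<inter> A = {x \<in> space M. (X x, X x) = b} \<inter> A" for b
        using A(3) by auto
    qed (intro simple_function_level_set simple_function_Pair X Z(1))+
    ultimately have "cond_ent M X Z - cond_ent M X X \<le> (\<Sum>b\<in>?S. d / k) + (\<Sum>c\<in>?S \<times> ?S. d / k)"
      unfolding eq[OF Z(2)] eq[OF subset_refl] by linarith
    also have "\<dots> = (k - 1) * (d / k)"
      using k_def by (simp only: sum_constant distrib_right[symmetric]) simp
    also have "\<dots> < d"
      using k \<open>0 < d\<close> by (simp add: field_simps)
    finally show ?thesis using zero by simp
  qed
  with e(1) show ?thesis by blast
qed

text \<open>On \<open>A\<close> the value of \<open>X\<close> can be decoded from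
  \<open>Y n\<close>. Conditioning on \<open>Y n\<close> is at least as good as conditioning on the
  decoded guess, which agrees with \<open>X\<close> with high probability.\<close>

lemma cond_ent_tendsto_0:
  assumes X: "simple_function M X" and Y: "\<And>n. simple_function M (Y n)"
    and approx: "\<And>e. 0 < e \<Longrightarrow> \<forall>\<^sub>F n in sequentially. \<exists>A\<in>events. 1 - e < prob A \<and>
      (\<forall>x\<in>A. \<forall>y\<in>A. Y n x = Y n y \<longrightarrow> X x = X y)"
  shows "(\<lambda>n. cond_ent M X (Y n)) \<longlonglongrightarrow> 0"
proof (rule order_tendstoI)
  show "\<forall>\<^sub>F n in sequentially. a < cond_ent M X (Y n)" if "a < 0" for a
    using that cond_ent_nonneg[OF X Y] by (intro always_eventually allI) (rule less_le_trans)
  fix d :: real assume "0 < d"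
  from cond_ent_small[OF X this] obtain e where "0 < e" and e:
    "\<And>Z A. simple_function M Z \<Longrightarrow> Z ` space M \<subseteq> X ` space M \<Longrightarrow> A \<in> events \<Longrightarrow>
       1 - e < prob A \<Longrightarrow> (\<forall>x\<in>A. Z x = X x) \<Longrightarrow> cond_ent M X Z < d"
    by blast
  show "\<forall>\<^sub>F n in sequentially. cond_ent M X (Y n) < d"
    using approx[OF \<open>0 < e\<close>]
  proof eventually_elim
    case (elim n)
    then obtain A where A: "A \<in> events" "1 - e < prob A"
      "\<And>x y. x \<in> A \<Longrightarrow> y \<in> A \<Longrightarrow> Y n x = Y n y \<Longrightarrow> X x = X y"
      by blast
    have sub: "A \<subseteq> space M" using A(1) sets.sets_into_space by blast
    obtain x0 where x0: "x0 \<in> space M" using not_empty by blast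
    \<comment> \<open>The decoder: the value of \<open>X\<close> at some point of \<open>A\<close>
      with the observed \<open>Y n\<close>. The point \<open>x0\<close> keeps the guess among the
      values of \<open>X\<close> when there is no such point.\<close>
    define g where "g w = X (if \<exists>y\<in>A. Y n y = w then SOME y. y \<in> A \<and> Y n y = w else x0)" for w
    have some: "(SOME y. y \<in> A \<and> Y n y = Y n x) \<in> A \<and> Y n (SOME y. y \<in> A \<and> Y n y = Y n x) = Y n x"
      if "\<exists>y\<in>A. Y n y = Y n x" for x
      by (rule someI_ex) (use that in blast)
    have gX: "g (Y n x) = X x" if x: "x \<in> A" for x
    proof -
      have ex: "\<exists>y\<in>A. Y n y = Y n x" using x by blast
      show ?thesis unfolding g_def using ex A(3)[OF _ x] some[OF ex] by simp
    qed
    have gS: "g (Y n x) \<in> X ` space M" for x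
      unfolding g_def using some[of x] sub x0 by auto
    have Z: "simple_function M (\<lambda>x. g (Y n x))" by (rule simple_function_compose1[OF Y])
    have "cond_ent M X (Y n) \<le> cond_ent M X (\<lambda>x. g (Y n x))"
      by (rule cond_ent_mono[OF X Y Z]) simp
    also have "\<dots> < d"
      by (rule e[OF Z _ A(1,2)]) (use gS gX in auto)
    finally show ?case .
  qed
qed

lemma simple_function_map:
  assumes "\<And>i. simple_function M (X i)"
  shows "simple_function M (\<lambda>x. map (\<lambda>i. X i x) [0..<n])"
proof (induction n)
  case (Suc n)
  then show ?case
    using simple_function_compose2[OF Suc assms[of n], of "\<lambda>l a. l @ [a]"] by simp
qed simp

text \<open>The chain rule reveals the \<open>X i\<close> one at a time given all
  \<open>Y i\<close>; discarding every condition except \<open>Y i\<close> bounds the cost of step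
  \<open>i\<close> by \<open>cond_ent M (X i) (Y i)\<close>.\<close>

lemma ent_map_le:
  assumes X: "\<And>i. simple_function M (X i)" and Y: "\<And>i. simple_function M (Y i)"
  shows "ent M (\<lambda>x. map (\<lambda>i. X i x) [0..<n]) \<le>
    ent M (\<lambda>x. map (\<lambda>i. Y i x) [0..<n]) + (\<Sum>i<n. cond_ent M (X i) (Y i))"
proof -
  define XL where "XL n x = map (\<lambda>i. X i x) [0..<n]" for n x
  define YL where "YL n x = map (\<lambda>i. Y i x) [0..<n]" for n x
  have XL: "simple_function M (XL n)" and YL: "simple_function M (YL n)" for n
    unfolding XL_def YL_def by (intro simple_function_map X Y)+
  have XYL: "simple_function M (\<lambda>x. (XL n x, YL m x))" for n m
    by (intro simple_function_Pair XL YL)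
  have "ent M (\<lambda>x. (XL n x, YL n x)) \<le> ent M (YL n) + (\<Sum>i<n. cond_ent M (X i) (Y i))" for n
  proof (induction n)
    case 0
    have "ent M (\<lambda>x. (XL 0 x, YL 0 x)) = ent M (YL 0)" by (rule ent_cong) (simp add: XL_def YL_def)
    then show ?case by simp
  next
    case (Suc n)
    have "ent M (\<lambda>x. (XL (Suc n) x, YL (Suc n) x)) = ent M (\<lambda>x. (X n x, XL n x, YL (Suc n) x))"
      by (rule ent_cong) (auto simp: XL_def)
    also have "\<dots> = cond_ent M (X n) (\<lambda>x. (XL n x, YL (Suc n) x)) + ent M (\<lambda>x. (XL n x, YL (Suc n) x))"
      by (simp add: cond_ent_def)
    also have "\<dots> = cond_ent M (X n) (\<lambda>x. (XL n x, YL (Suc n) x)) + cond_ent M (XL n) (YL (Suc n))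
        + ent M (YL (Suc n))"
      by (simp add: cond_ent_def)
    also have "cond_ent M (X n) (\<lambda>x. (XL n x, YL (Suc n) x)) \<le> cond_ent M (X n) (Y n)"
      by (rule cond_ent_mono[OF X XYL Y]) (simp add: YL_def)
    also have "cond_ent M (XL n) (YL (Suc n)) \<le> cond_ent M (XL n) (YL n)"
      by (rule cond_ent_mono[OF XL YL YL]) (simp add: YL_def)
    finally show ?case using Suc by (simp add: cond_ent_def)
  qed
  moreover have "ent M (XL n) \<le> ent M (\<lambda>x. (XL n x, YL n x))"
    by (rule ent_mono[OF XYL XL]) simp
  ultimately have "ent M (XL n) \<le> ent M (YL n) + (\<Sum>i<n. cond_ent M (X i) (Y i))"
    using order_trans by blast
  then show ?thesis by (simp only: XL_def[abs_def] YL_def[abs_def])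
qed

end

subsection \<open>Entropy of a partition under a map\<close>

text \<open>Turns a partition into a function with the same level sets, so that joins of partitions
  become lists of values.\<close>

definition cell :: "'x set set \<Rightarrow> 'x \<Rightarrow> 'x set" where
  "cell P x = (THE A. A \<in> P \<and> x \<in> A)"

lemma cell_eqI:
  assumes "partition_on S P" "A \<in> P" "x \<in> A"
  shows "cell P x = A"
  unfolding cell_def
proof (rule the_equality)
  show "A \<in> P \<and> x \<in> A" using assms by blast
  show "B = A" if "B \<in> P \<and> x \<in> B" for B
    using partition_onD2[OF assms(1)] that assms(2,3) by (meson disjointD disjoint_iff)
qed

lemma cell_props:
  assumes "partition_on S P" "x \<in> S"
  shows "cell P x \<in> P" "x \<in> cell P x"
proof -
  obtain A where "A \<in> P" "x \<in> A" using partition_onD1[OF assms(1)] assms(2) by blast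
  then show "cell P x \<in> P" "x \<in> cell P x" using cell_eqI[OF assms(1)] by simp_all
qed

lemma simple_function_cell:
  assumes "finite_measurable_partition M P"
  shows "simple_function M (cell P)"
  unfolding simple_function_def
proof
  have P: "finite P" "P \<subseteq> sets M" "partition_on (space M) P"
    using assms by (auto simp: finite_measurable_partition_def)
  show "finite (cell P ` space M)"
    by (rule finite_subset[OF _ P(1)]) (use cell_props(1)[OF P(3)] in blast)
  show "\<forall>A\<in>cell P ` space M. cell P -` {A} \<inter> space M \<in> sets M"
  proof
    fix A assume "A \<in> cell P ` space M"
    then have A: "A \<in> P" using cell_props(1)[OF P(3)] by blast
    have "cell P -` {A} \<inter> space M = A"
      using cell_props(2)[OF P(3)] cell_eqI[OF P(3) A] partition_onD1[OF P(3)] A by blast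
    then show "cell P -` {A} \<inter> space M \<in> sets M" using A P(2) by auto
  qed
qed

lemma preserves_measure_funpow:
  assumes "preserves_measure M T"
  shows "preserves_measure M (T ^^ n)"
proof (induction n)
  case (Suc n)
  have T: "T \<in> M \<rightarrow>\<^sub>M M" and Tn: "(T ^^ n) \<in> M \<rightarrow>\<^sub>M M"
    using assms Suc by (auto simp: preserves_measure_def)
  have "emeasure M ((T ^^ Suc n) -` B \<inter> space M) = emeasure M B" if B: "B \<in> sets M" for B
  proof -
    have "(T ^^ Suc n) -` B \<inter> space M = (T ^^ n) -` (T -` B \<inter> space M) \<inter> space M"
      using measurable_space[OF Tn] by auto
    then show ?thesis
      using Suc assms B measurable_sets[OF T B] by (simp only: preserves_measure_def)
  qed
  then show ?case using measurable_comp[OF Tn T] by (simp add: preserves_measure_def comp_def)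
qed (simp add: preserves_measure_def sets.sets_into_space Int_absorb2)

lemma simple_function_preserves:
  assumes "preserves_measure M T" "simple_function M X"
  shows "simple_function M (\<lambda>x. X (T x))"
  using simple_function_comp[of T M M X] assms by (simp add: preserves_measure_def)

lemma ent_preserves:
  assumes T: "preserves_measure M T" and X: "simple_function M X"
  shows "ent M (\<lambda>x. X (T x)) = ent M X"
proof -
  have Tm: "T \<in> M \<rightarrow>\<^sub>M M" using T by (simp add: preserves_measure_def)
  have fin: "finite (X ` space M)" using X by (simp add: simple_function_def)
  have "measure M {x \<in> space M. X (T x) = c} = measure M {x \<in> space M. X x = c}" for c
  proof -
    have "{x \<in> space M. X (T x) = c} = T -` {x \<in> space M. X x = c} \<inter> space M"
      using measurable_space[OF Tm] by auto
    moreover have "{x \<in> space M. X x = c} \<in> sets M"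
      using simple_functionD(2)[OF X, of "{c}"] by (simp add: vimage_def Int_def conj_commute)
    ultimately show ?thesis using T by (simp only: preserves_measure_def measure_def)
  qed
  moreover have "(\<lambda>x. X (T x)) ` space M \<subseteq> X ` space M"
    using measurable_space[OF Tm] by auto
  ultimately show ?thesis
    by (subst (1 2) ent_eq_sum[OF fin]) simp_all
qed

lemma cond_ent_preserves:
  assumes "preserves_measure M T" "simple_function M X" "simple_function M Y"
  shows "cond_ent M (\<lambda>x. X (T x)) (\<lambda>x. Y (T x)) = cond_ent M X Y"
  using ent_preserves[OF assms(1) simple_function_Pair[OF assms(2,3)]] ent_preserves[OF assms(1,3)]
  by (simp add: cond_ent_def)

text \<open>The join is built from choice functions, one cell from each pullback; its cells turn out
  to be the classes of points with equal itineraries through \<open>P\<close> during the first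
  \<open>n\<close> steps.\<close>

lemma partition_entropy_iterated_join:
  assumes P: "partition_on (space M) P" and T: "T \<in> M \<rightarrow>\<^sub>M M" and "n \<ge> 1"
  shows "partition_entropy M (iterated_join M T P n) = ent M (\<lambda>x. map (\<lambda>i. cell P ((T ^^ i) x)) [0..<n])"
proof -
  define Q where "Q i = pullback_partition M (T ^^ i) P" for i
  define cls where "cls x = {y \<in> space M. \<forall>i<n. cell P ((T ^^ i) y) = cell P ((T ^^ i) x)}" for x
  have Ts: "(T ^^ i) x \<in> space M" if "x \<in> space M" for i x
    using that by (induction i) (auto intro: measurable_space[OF T])
  have Q: "partition_on (space M) (Q i)" for i
  proof (rule partition_onI)
    show "\<Union>(Q i) = space M"
    proof (intro subset_antisym subsetI)
      fix x assume x: "x \<in> space M"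
      let ?A = "cell P ((T ^^ i) x)"
      have "?A \<in> P" "(T ^^ i) x \<in> ?A" using cell_props[OF P Ts[OF x]] by blast+
      then have "(T ^^ i) -` ?A \<inter> space M \<in> Q i" "x \<in> (T ^^ i) -` ?A \<inter> space M"
        unfolding Q_def pullback_partition_def using x by blast+
      then show "x \<in> \<Union>(Q i)" by (rule UnionI)
    qed (auto simp: Q_def pullback_partition_def)
    show "{} \<notin> Q i" by (simp add: Q_def pullback_partition_def)
    fix p q assume pq: "p \<in> Q i" "q \<in> Q i" "p \<noteq> q"
    then obtain A B where "A \<in> P" "B \<in> P" "p = (T ^^ i) -` A \<inter> space M" "q = (T ^^ i) -` B \<inter> space M"
      unfolding Q_def pullback_partition_def by blast
    moreover from this have "A \<inter> B = {}" using pq(3) partition_onD2[OF P] by (auto simp: disjoint_def)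
    ultimately show "disjnt p q" unfolding disjnt_def by blast
  qed
  \<comment> \<open>A cell of the refinement is the itinerary class of each of its points. Since the
    refinement covers the space, this identifies the two families.\<close>
  have sub: "D = cls z" if D: "D \<in> common_refinement (Q ` {..<n})" and z: "z \<in> D" for D z
  proof -
    obtain f where f: "f \<in> (\<Pi> p\<in>Q ` {..<n}. p)" and Df: "D = \<Inter>(f ` Q ` {..<n})"
      using D unfolding common_refinement by blast
    \<comment> \<open>Index 0 is available because \<open>n \<ge> 1\<close>; it places
      \<open>z\<close> in the space.\<close>
    have "z \<in> f (Q 0)" using z Df \<open>n \<ge> 1\<close> by auto
    moreover have "f (Q 0) \<in> Q 0" using f \<open>n \<ge> 1\<close> by auto
    ultimately have zs: "z \<in> space M" using partition_onD1[OF Q] by blast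
    have fQ: "f (Q i) = {y \<in> space M. cell P ((T ^^ i) y) = cell P ((T ^^ i) z)}" if "i < n" for i
    proof -
      have "f (Q i) \<in> Q i" using f that by auto
      then obtain A where A: "A \<in> P" "f (Q i) = (T ^^ i) -` A \<inter> space M"
        unfolding Q_def pullback_partition_def by blast
      have "z \<in> f (Q i)" using z Df that by auto
      then have "cell P ((T ^^ i) z) = A" using A cell_eqI[OF P A(1)] by blast
      then show ?thesis using A cell_eqI[OF P A(1)] cell_props[OF P Ts[of _ i]] by blast
    qed
    have "D = (\<Inter>i\<in>{..<n}. f (Q i))" unfolding Df by (simp add: image_image)
    also have "\<dots> = cls z" using fQ \<open>n \<ge> 1\<close> by (fastforce simp: cls_def)
    finally show ?thesis .
  qed
  have "Q ` {..<n} \<noteq> {}" using \<open>n \<ge> 1\<close> by (auto simp: lessThan_empty_iff)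
  then have part: "partition_on (space M) (common_refinement (Q ` {..<n}))"
    using Q by (intro partition_on_common_refinement) auto
  have "common_refinement (Q ` {..<n}) = cls ` space M"
  proof (intro subset_antisym subsetI)
    fix D assume D: "D \<in> common_refinement (Q ` {..<n})"
    then obtain z where z: "z \<in> D" using partition_onD3[OF part] by fastforce
    moreover have "z \<in> space M" using partition_onD1[OF part] D z by blast
    ultimately show "D \<in> cls ` space M" using sub[OF D z] by blast
  next
    fix D assume "D \<in> cls ` space M"
    then obtain x where x: "x \<in> space M" "D = cls x" by blast
    then obtain D' where D': "D' \<in> common_refinement (Q ` {..<n})" "x \<in> D'"
      using partition_onD1[OF part] by blast
    then show "D \<in> common_refinement (Q ` {..<n})" using sub[OF D'] x by simp
  qed
  moreover have "cls x = {y \<in> space M. map (\<lambda>i. cell P ((T ^^ i) y)) [0..<n] = map (\<lambda>i. cell P ((T ^^ i) x)) [0..<n]}" for x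
    by (simp add: cls_def atLeast0LessThan Ball_def)
  ultimately show ?thesis by (simp add: ent_def iterated_join_def Q_def)
qed

context prob_space
begin

lemma ent_nonneg:
  assumes "simple_function M X"
  shows "0 \<le> ent M X"
proof -
  have "ent M (\<lambda>_. ()) \<le> ent M X" by (rule ent_mono[OF assms]) simp_all
  moreover have "ent M (\<lambda>_. ()) = 0" by (subst ent_eq_sum[of "{()}"]) (auto simp: prob_space)
  ultimately show ?thesis by simp
qed

text \<open>The inequality h(P) \<le> h(Y) + H(P | Y), where the first term vanishes for every
  \<open>l\<close> and the second becomes small. Convergence is proved along with the value, as the
  entropy is defined by \<open>lim\<close>.\<close>

lemma entropy_wrt_partition_eq_0:
  assumes T: "preserves_measure M T" and P: "finite_measurable_partition M P"
    and Y: "\<And>l. simple_function M (Y l)"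
    and rate: "\<And>l. (\<lambda>n. ent M (\<lambda>x. map (\<lambda>i. Y l ((T ^^ i) x)) [0..<n]) / real n) \<longlonglongrightarrow> 0"
    and cond: "(\<lambda>l. cond_ent M (cell P) (Y l)) \<longlonglongrightarrow> 0"
  shows "entropy_wrt_partition M T P = 0"
  unfolding entropy_wrt_partition_def
proof (rule limI, rule order_tendstoI)
  have C: "simple_function M (cell P)" using P by (rule simple_function_cell)
  have Ti: "preserves_measure M (T ^^ i)" for i by (rule preserves_measure_funpow[OF T])
  have Ci: "simple_function M (\<lambda>x. cell P ((T ^^ i) x))" for i
    by (rule simple_function_preserves[OF Ti C])
  have Yi: "simple_function M (\<lambda>x. Y l ((T ^^ i) x))" for l i
    by (rule simple_function_preserves[OF Ti Y])
  let ?h = "\<lambda>n. partition_entropy M (iterated_join M T P n) / real n"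
  have h: "?h n = ent M (\<lambda>x. map (\<lambda>i. cell P ((T ^^ i) x)) [0..<n]) / real n" if "n \<ge> 1" for n
    using P T that by (subst partition_entropy_iterated_join)
      (auto simp: finite_measurable_partition_def preserves_measure_def)
  have nn: "0 \<le> ?h n" if "n \<ge> 1" for n
    unfolding h[OF that] by (intro divide_nonneg_nonneg ent_nonneg simple_function_map Ci) simp
  show "\<forall>\<^sub>F n in sequentially. a < ?h n" if "a < 0" for a
    using eventually_ge_at_top[of 1] by eventually_elim (use that nn less_le_trans in blast)
  fix e :: real assume "0 < e"
  then have "\<forall>\<^sub>F l in sequentially. cond_ent M (cell P) (Y l) < e / 2"
    by (intro order_tendstoD(2)[OF cond]) simp
  then obtain l where l: "cond_ent M (cell P) (Y l) < e / 2"
    using eventually_happens sequentially_bot by blast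
  have "\<forall>\<^sub>F n in sequentially. ent M (\<lambda>x. map (\<lambda>i. Y l ((T ^^ i) x)) [0..<n]) / real n < e / 2"
    using \<open>0 < e\<close> by (intro order_tendstoD(2)[OF rate]) simp
  then show "\<forall>\<^sub>F n in sequentially. ?h n < e"
    using eventually_ge_at_top[of 1]
  proof eventually_elim
    case (elim n)
    have "ent M (\<lambda>x. map (\<lambda>i. cell P ((T ^^ i) x)) [0..<n]) \<le>
        ent M (\<lambda>x. map (\<lambda>i. Y l ((T ^^ i) x)) [0..<n]) + (\<Sum>i<n. cond_ent M (cell P) (Y l))"
      using ent_map_le[of "\<lambda>i x. cell P ((T ^^ i) x)" "\<lambda>i x. Y l ((T ^^ i) x)" n, OF Ci Yi]
      by (simp only: cond_ent_preserves[OF Ti C Y])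
    then have "?h n \<le> (ent M (\<lambda>x. map (\<lambda>i. Y l ((T ^^ i) x)) [0..<n]) + real n * cond_ent M (cell P) (Y l)) / real n"
      unfolding h[OF elim(2)] by (intro divide_right_mono) simp_all
    also have "\<dots> = ent M (\<lambda>x. map (\<lambda>i. Y l ((T ^^ i) x)) [0..<n]) / real n + cond_ent M (cell P) (Y l)"
      using elim(2) by (simp add: add_divide_distrib)
    finally show ?case using elim(1) l by linarith
  qed
qed

end

subsection \<open>Bipermutative cellular automata\<close>

text \<open>Bipermutativity in terms of configurations, so that no words occur afterwards:
  uniqueness and existence of the outermost letter, separately for each end.\<close>

locale permutative_ca =
  fixes F :: "(int \<Rightarrow> 'a::alphabet) \<Rightarrow> (int \<Rightarrow> 'a)" and r s :: int
  assumes rs: "r < s"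
    and local: "\<And>x y m. (\<And>i. m + r \<le> i \<Longrightarrow> i \<le> m + s \<Longrightarrow> x i = y i) \<Longrightarrow> F x m = F y m"
    and right_inj: "\<And>x y m. (\<And>i. m + r \<le> i \<Longrightarrow> i < m + s \<Longrightarrow> x i = y i) \<Longrightarrow> F x m = F y m \<Longrightarrow>
        x (m + s) = y (m + s)"
    and left_inj: "\<And>x y m. (\<And>i. m + r < i \<Longrightarrow> i \<le> m + s \<Longrightarrow> x i = y i) \<Longrightarrow> F x m = F y m \<Longrightarrow>
        x (m + r) = y (m + r)"
    and right_ex: "\<And>x m b. \<exists>a. F (x(m + s := a)) m = b"
    and left_ex: "\<And>x m b. \<exists>a. F (x(m + r := a)) m = b"
    and continuous: "continuous_on UNIV F"
    and commutes: "\<And>x. F (shift_map x) = shift_map (F x)"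

lemma permutative_ca_of_bipermutative:
  assumes ca: "cellular_automaton F" and nt: "nontrivial_ca F" and bi: "bipermutative F"
  obtains r s where "permutative_ca F r s"
proof -
  obtain r s f where sn: "smallest_neighborhood F r s" and lr: "local_rule F r s f"
    and f: "\<And>u b. length u = nat (s - r) \<Longrightarrow> (\<exists>!a. f (a # u) = b) \<and> (\<exists>!a. f (u @ [a]) = b)"
    using bi unfolding bipermutative_def by blast
  obtain r' s' where sn': "smallest_neighborhood F r' s'" "r' \<noteq> s'"
    using nt unfolding nontrivial_ca_def by blast
  \<comment> \<open>Nontriviality and bipermutativity each come with their own smallest
    neighborhood; these contain one another.\<close>
  have "{r..s} = {r'..s'}" "r \<le> s" "r' \<le> s'"
    using sn sn'(1) unfolding smallest_neighborhood_def neighborhood_def by blast+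
  then have rs: "r < s" using sn'(2) by (auto simp: Icc_eq_Icc)
  have Fx: "F x m = f (map (\<lambda>u. x (m + u)) [r..s])" for x m
    using lr by (simp add: local_rule_def)
  have FL: "F x m = f (x (m + r) # map (\<lambda>u. x (m + u)) [r+1..s])" for x m
    using rs by (simp add: Fx upto_rec1[of r s])
  have FR: "F x m = f (map (\<lambda>u. x (m + u)) [r..s-1] @ [x (m + s)])" for x m
    using rs by (simp add: Fx upto_rec2[of r s])
  have "permutative_ca F r s"
  proof
    show "r < s" by (rule rs)
    show "F x m = F y m" if "\<And>i. m + r \<le> i \<Longrightarrow> i \<le> m + s \<Longrightarrow> x i = y i" for x y m
    proof -
      have "map (\<lambda>u. x (m + u)) [r..s] = map (\<lambda>u. y (m + u)) [r..s]"
        by (rule map_cong[OF refl], rule that) auto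
      then show ?thesis by (simp only: Fx)
    qed
    show "x (m + s) = y (m + s)"
      if xy: "\<And>i. m + r \<le> i \<Longrightarrow> i < m + s \<Longrightarrow> x i = y i" and eq: "F x m = F y m" for x y m
    proof -
      have u: "map (\<lambda>u. x (m + u)) [r..s-1] = map (\<lambda>u. y (m + u)) [r..s-1]"
        by (rule map_cong[OF refl], rule xy) auto
      have "length (map (\<lambda>u. y (m + u)) [r..s-1]) = nat (s - r)" by simp
      from f[OF this, of "F y m"] eq show ?thesis unfolding FR u by blast
    qed
    show "x (m + r) = y (m + r)"
      if xy: "\<And>i. m + r < i \<Longrightarrow> i \<le> m + s \<Longrightarrow> x i = y i" and eq: "F x m = F y m" for x y m
    proof -
      have u: "map (\<lambda>u. x (m + u)) [r+1..s] = map (\<lambda>u. y (m + u)) [r+1..s]"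
        by (rule map_cong[OF refl], rule xy) auto
      have "length (map (\<lambda>u. y (m + u)) [r+1..s]) = nat (s - r)" by simp
      from f[OF this, of "F y m"] eq show ?thesis unfolding FL u by blast
    qed
    show "\<exists>a. F (x(m + s := a)) m = b" for x m b
    proof -
      have u: "map (\<lambda>u. (x(m + s := a)) (m + u)) [r..s-1] = map (\<lambda>u. x (m + u)) [r..s-1]" for a
        by (rule map_cong[OF refl]) auto
      have "length (map (\<lambda>u. x (m + u)) [r..s-1]) = nat (s - r)" by simp
      from f[OF this, of b] show ?thesis unfolding FR u by auto
    qed
    show "\<exists>a. F (x(m + r := a)) m = b" for x m b
    proof -
      have u: "map (\<lambda>u. (x(m + r := a)) (m + u)) [r+1..s] = map (\<lambda>u. x (m + u)) [r+1..s]" for a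
        by (rule map_cong[OF refl]) auto
      have "length (map (\<lambda>u. x (m + u)) [r+1..s]) = nat (s - r)" by simp
      from f[OF this, of b] show ?thesis unfolding FL u by auto
    qed
    show "continuous_on UNIV F" "F (shift_map x) = shift_map (F x)" for x
      using ca by (auto simp: cellular_automaton_def)
  qed
  then show thesis by (rule that)
qed

section \<open>Extending words and constructing preimages\<close>

context permutative_ca
begin

text \<open>Each letter of the image yields one more letter of the configuration by right
  permutativity. The image position \<open>a - r\<close> reads the window from \<open>a\<close> to
  \<open>a + (s - r)\<close>, whence the offset.\<close>

lemma extend_right:
  assumes "\<And>i. a \<le> i \<Longrightarrow> i < a + (s - r) \<Longrightarrow> x i = y i"
    and "\<And>m. a - r \<le> m \<Longrightarrow> m < a - r + int n \<Longrightarrow> F x m = F y m"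
  shows "a \<le> i \<Longrightarrow> i < a + (s - r) + int n \<Longrightarrow> x i = y i"
  using assms(2)
proof (induction n arbitrary: i)
  case 0
  then show ?case using assms(1) by simp
next
  case (Suc n)
  have IH: "x j = y j" if "a \<le> j" "j < a + (s - r) + int n" for j
    by (rule Suc.IH[OF that]) (rule Suc.prems(3); simp)
  show ?case
  proof (cases "i = a + (s - r) + int n")
    case True
    have "x ((a - r + int n) + s) = y ((a - r + int n) + s)"
      by (rule right_inj, rule IH) (use Suc.prems(3)[of "a - r + int n"] in simp_all)
    moreover have "(a - r + int n) + s = i" using True by simp
    ultimately show ?thesis by simp
  next
    case False
    then show ?thesis using Suc.prems(1,2) by (intro IH) simp_all
  qed
qed

lemma extend_left:
  assumes "\<And>i. a \<le> i \<Longrightarrow> i < a + (s - r) \<Longrightarrow> x i = y i"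
    and "\<And>m. a - r - int n \<le> m \<Longrightarrow> m < a - r \<Longrightarrow> F x m = F y m"
  shows "a - int n \<le> i \<Longrightarrow> i < a + (s - r) \<Longrightarrow> x i = y i"
  using assms(2)
proof (induction n arbitrary: i)
  case 0
  then show ?case using assms(1) by simp
next
  case (Suc n)
  have IH: "x j = y j" if "a - int n \<le> j" "j < a + (s - r)" for j
    by (rule Suc.IH[OF that]) (rule Suc.prems(3); simp)
  show ?case
  proof (cases "i = a - int n - 1")
    case True
    have "x ((a - r - int n - 1) + r) = y ((a - r - int n - 1) + r)"
      by (rule left_inj, rule IH) (use Suc.prems(3)[of "a - r - int n - 1"] in simp_all)
    moreover have "(a - r - int n - 1) + r = i" using True by simp
    ultimately show ?thesis by simp
  next
    case False
    then show ?thesis using Suc.prems(1,2) by (intro IH) simp_all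
  qed
qed

text \<open>Extension in both directions from one window of length \<open>s - r\<close>. It gives
  finiteness of the kernel and injectivity of \<open>F\<close> on long cylinders.\<close>

lemma image_determines:
  assumes "\<And>i. a \<le> i \<Longrightarrow> i < a + (s - r) \<Longrightarrow> x i = y i" and "F x = F y"
  shows "x = y"
proof
  fix i
  let ?n = "nat \<bar>i - a\<bar>"
  show "x i = y i"
  proof (cases "a \<le> i")
    case True
    show ?thesis
      by (rule extend_right[of a x y "?n + 1"], rule assms(1)) (use assms(2) True rs in auto)
  next
    case False
    show ?thesis
      by (rule extend_left[of a x y ?n], rule assms(1)) (use assms(2) False rs in auto)
  qed
qed

lemma preimage_step:
  assumes "\<And>m. a - r - int n \<le> m \<Longrightarrow> m < a - r + int n \<Longrightarrow> F z m = y m"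
  shows "\<exists>z'. (\<forall>i. a - int n \<le> i \<longrightarrow> i < a + (s - r) + int n \<longrightarrow> z' i = z i) \<and>
    (\<forall>m. a - r - int (Suc n) \<le> m \<longrightarrow> m < a - r + int (Suc n) \<longrightarrow> F z' m = y m)"
proof -
  \<comment> \<open>\<open>p\<close> and \<open>q\<close> are the next image positions to the right
    and left. The letters at \<open>p + s\<close> and \<open>q + r\<close> that correct them lie
    just outside the interval already fixed and influence no image position strictly between
    \<open>q\<close> and \<open>p\<close>.\<close>
  define p where "p = a - r + int n"
  define q where "q = a - r - int (Suc n)"
  obtain c where c: "F (z(p + s := c)) p = y p" using right_ex by blast
  define z1 where "z1 = z(p + s := c)"
  obtain d where d: "F (z1(q + r := d)) q = y q" using left_ex by blast
  define z2 where "z2 = z1(q + r := d)"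
  have 2: "F z2 m = F z1 m" if "q < m" for m
    by (rule local) (use that in \<open>auto simp: z2_def\<close>)
  have 1: "F z1 m = F z m" if "m < p" for m
    by (rule local) (use that in \<open>auto simp: z1_def\<close>)
  have "F z2 m = y m" if m: "a - r - int (Suc n) \<le> m" "m < a - r + int (Suc n)" for m
  proof (cases "m = q")
    case True
    then show ?thesis using d by (simp add: z2_def)
  next
    case False
    then have q: "q < m" using m by (simp add: q_def)
    show ?thesis
    proof (cases "m = p")
      case True
      then show ?thesis using c 2[OF q] by (simp add: z1_def)
    next
      case False
      then have "m < p" using m by (simp add: p_def)
      then show ?thesis using 1 2[OF q] assms[of m] q by (simp add: p_def q_def)
    qed
  qed
  moreover have "z2 i = z i" if "a - int n \<le> i" "i < a + (s - r) + int n" for i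
    using that by (simp add: z2_def z1_def p_def q_def)
  ultimately show ?thesis by blast
qed

text \<open>The image is corrected one position further on each side at every stage. Each letter
  changes at finitely many stages only, so the stages have a limit.\<close>

lemma preimage_with_prefix:
  "\<exists>z. F z = y \<and> (\<forall>i. a \<le> i \<longrightarrow> i < a + (s - r) \<longrightarrow> z i = x i)"
proof -
  let ?P = "\<lambda>n z. (\<forall>i. a \<le> i \<longrightarrow> i < a + (s - r) \<longrightarrow> z i = x i) \<and>
     (\<forall>m. a - r - int n \<le> m \<longrightarrow> m < a - r + int n \<longrightarrow> F z m = y m)"
  let ?Q = "\<lambda>n z z'. \<forall>i. a - int n \<le> i \<longrightarrow> i < a + (s - r) + int n \<longrightarrow> z' i = z i"
  have "\<exists>Z. \<forall>n. ?P n (Z n) \<and> ?Q n (Z n) (Z (Suc n))"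
  proof (rule dependent_nat_choice)
    show "\<exists>z. ?P 0 z" by (rule exI[of _ x]) simp
    fix z n assume P: "?P n z"
    then have "\<And>m. a - r - int n \<le> m \<Longrightarrow> m < a - r + int n \<Longrightarrow> F z m = y m" by blast
    from preimage_step[OF this] obtain z' where z':
      "\<And>i. a - int n \<le> i \<Longrightarrow> i < a + (s - r) + int n \<Longrightarrow> z' i = z i"
      "\<And>m. a - r - int (Suc n) \<le> m \<Longrightarrow> m < a - r + int (Suc n) \<Longrightarrow> F z' m = y m"
      by blast
    have "z' i = x i" if "a \<le> i" "i < a + (s - r)" for i
      using z'(1)[of i] P that by simp
    then show "\<exists>z'. ?P (Suc n) z' \<and> ?Q n z z'" using z' by (intro exI[of _ z']) blast
  qed
  then obtain Z where P: "\<And>n. ?P n (Z n)" and Q: "\<And>n. ?Q n (Z n) (Z (Suc n))" by blast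
  have Q': "Z (n + k) i = Z n i" if "a - int n \<le> i" "i < a + (s - r) + int n" for n k i
  proof (induction k)
    case (Suc k)
    have "Z (Suc (n + k)) i = Z (n + k) i" using Q[of "n + k"] that by simp
    then show ?case using Suc by simp
  qed simp
  \<comment> \<open>At this stage the fixed interval around \<open>a\<close> contains
    \<open>i\<close>, and no later stage alters the letter.\<close>
  define z where "z i = Z (nat \<bar>i - a\<bar> + 1) i" for i
  have z: "z i = Z n i" if "a - int n \<le> i" "i < a + (s - r) + int n" for i n
  proof -
    let ?k = "nat \<bar>i - a\<bar> + 1"
    have "Z (?k + n) i = Z ?k i" by (rule Q') (use rs in auto)
    moreover have "Z (n + ?k) i = Z n i" by (rule Q'[OF that])
    ultimately show ?thesis by (simp add: z_def add.commute)
  qed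
  have "F z m = y m" for m
  proof -
    \<comment> \<open>Large enough for the fixed interval to contain all of \<open>m + r\<close> to
      \<open>m + s\<close> and for the image at \<open>m\<close> to be already correct.\<close>
    define n where "n = nat \<bar>m\<bar> + nat \<bar>r\<bar> + nat \<bar>s\<bar> + nat \<bar>a\<bar> + 1"
    have n: "int n = \<bar>m\<bar> + \<bar>r\<bar> + \<bar>s\<bar> + \<bar>a\<bar> + 1" by (simp add: n_def)
    have "F z m = F (Z n) m"
      by (rule local, rule z) (use n rs in linarith)+
    also have "\<dots> = y m"
    proof -
      have "a - r - int n \<le> m" "m < a - r + int n" using n by linarith+
      then show ?thesis using P[of n] by blast
    qed
    finally show ?thesis .
  qed
  moreover have "z i = x i" if "a \<le> i" "i < a + (s - r)" for i
    using z[of 0 i] P[of 0] that by simp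
  ultimately show ?thesis by blast
qed

text \<open>Each iterate adds \<open>s - r\<close> free letters: \<open>e\<close> is chosen to agree
  with \<open>F x\<close> on \<open>n * (s - r)\<close> letters, \<open>z\<close> over
  \<open>e\<close> to agree with \<open>x\<close> on \<open>s - r\<close> letters, and
  \<open>extend_right\<close> carries the agreement along.\<close>

lemma iterated_preimage_with_prefix:
  "\<exists>z. (F ^^ n) z = y \<and> (\<forall>i. a \<le> i \<longrightarrow> i < a + int n * (s - r) \<longrightarrow> z i = x i)"
proof (induction n arbitrary: a x)
  case (Suc n)
  obtain e where e: "(F ^^ n) e = y" "\<And>i. a - r \<le> i \<Longrightarrow> i < a - r + int n * (s - r) \<Longrightarrow> e i = F x i"
    using Suc[of "a - r" "F x"] by blast
  obtain z where z: "F z = e" "\<And>i. a \<le> i \<Longrightarrow> i < a + (s - r) \<Longrightarrow> z i = x i"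
    using preimage_with_prefix by blast
  have pos: "0 \<le> int n * (s - r)" using rs by simp
  have "z i = x i" if "a \<le> i" "i < a + int (Suc n) * (s - r)" for i
  proof (rule extend_right[of a z x "nat (int n * (s - r))"])
    show "F z m = F x m" if "a - r \<le> m" "m < a - r + int (nat (int n * (s - r)))" for m
      using e(2)[of m] z(1) that pos by simp
    show "i < a + (s - r) + int (nat (int n * (s - r)))"
      using that(2) pos by (simp add: distrib_right)
  qed (use z(2) that in auto)
  moreover have "(F ^^ Suc n) z = y" using e(1) z(1) by (simp add: funpow_swap1)
  ultimately show ?case by blast
qed simp

end

subsection \<open>Zero entropy when the map is almost everywhere injective\<close>

lemma restrict_eq_iff: "restrict x I = restrict y I \<longleftrightarrow> (\<forall>i\<in>I. x i = y i)"
proof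
  assume "restrict x I = restrict y I"
  then have "restrict x I i = restrict y I i" for i by simp
  then show "\<forall>i\<in>I. x i = y i" by (metis restrict_apply')
qed (auto simp: restrict_def fun_eq_iff)

lemma simple_function_word:
  fixes \<mu> :: "(int \<Rightarrow> 'a::alphabet) measure"
  assumes "sets \<mu> = sets borel" "finite I"
  shows "simple_function \<mu> (\<lambda>x. restrict x I)"
  unfolding simple_function_def
proof
  have sp: "space \<mu> = UNIV" using sets_eq_imp_space_eq[OF assms(1)] by simp
  have "finite (PiE I (\<lambda>_. UNIV :: 'a set))" using assms(2) by (intro finite_PiE) auto
  then show "finite ((\<lambda>x. restrict x I) ` space \<mu>)" by (rule finite_subset[rotated]) auto
  show "\<forall>w\<in>(\<lambda>x. restrict x I) ` space \<mu>. (\<lambda>x. restrict x I) -` {w} \<inter> space \<mu> \<in> sets \<mu>"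
  proof
    fix w assume "w \<in> (\<lambda>x. restrict x I) ` space \<mu>"
    then obtain z where w: "w = restrict z I" by blast
    have "(\<lambda>x. restrict x I) -` {w} \<inter> space \<mu> = (\<Inter>i\<in>I. {y. y i \<in> {z i}})"
      unfolding w sp by (auto simp: restrict_eq_iff)
    moreover have "open (\<Inter>i\<in>I. {y :: int \<Rightarrow> 'a. y i \<in> {z i}})"
      by (intro open_INT assms(2) ballI open_vimage_coord)
    ultimately show "(\<lambda>x. restrict x I) -` {w} \<inter> space \<mu> \<in> sets \<mu>"
      using assms(1) by simp
  qed
qed

lemma funpow_shift_map: "(shift_map ^^ k) x i = x (i + int k)"
  by (induction k arbitrary: i) (simp_all add: shift_map_def algebra_simps)

lemma ent_word_translate:
  fixes \<mu> :: "(int \<Rightarrow> 'a::alphabet) measure"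
  assumes s: "sets \<mu> = sets borel" and \<sigma>: "preserves_measure \<mu> shift_map"
  shows "ent \<mu> (\<lambda>x. restrict x {c..<c + int M}) = ent \<mu> (\<lambda>x. restrict x {0..<int M})"
proof -
  have shift: "ent \<mu> (\<lambda>x. restrict x {a + int k..<a + int k + int M}) = ent \<mu> (\<lambda>x. restrict x {a..<a + int M})"
    for a k
  proof -
    have "ent \<mu> (\<lambda>x. restrict x {a + int k..<a + int k + int M}) =
        ent \<mu> (\<lambda>x. restrict ((shift_map ^^ k) x) {a..<a + int M})"
    proof (rule ent_cong)
      fix x y :: "int \<Rightarrow> 'a"
      have "{a + int k..<a + int k + int M} = (\<lambda>i. i + int k) ` {a..<a + int M}"
        by (simp add: ac_simps)
      then show "restrict x {a + int k..<a + int k + int M} = restrict y {a + int k..<a + int k + int M} \<longleftrightarrow>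
          restrict ((shift_map ^^ k) x) {a..<a + int M} = restrict ((shift_map ^^ k) y) {a..<a + int M}"
        by (simp only: restrict_eq_iff funpow_shift_map ball_simps)
    qed
    also have "\<dots> = ent \<mu> (\<lambda>x. restrict x {a..<a + int M})"
      by (rule ent_preserves[OF preserves_measure_funpow[OF \<sigma>] simple_function_word[OF s]]) simp
    finally show ?thesis .
  qed
  show ?thesis
  proof (cases "0 \<le> c")
    case True
    then show ?thesis using shift[of 0 "nat c"] by simp
  next
    case False
    \<comment> \<open>For negative \<open>c\<close> the window at \<open>c\<close> is moved forward
      to 0, so only forward powers of the shift occur.\<close>
    then show ?thesis using shift[of c "nat (- c)"] by simp
  qed
qed

text \<open>An averaging argument along steps of length \<open>W\<close>, with monotonicity filling
  in between them.\<close>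

lemma sublinear_of_increments:
  fixes a :: "nat \<Rightarrow> real"
  assumes mono: "\<And>m n. m \<le> n \<Longrightarrow> a m \<le> a n" and nn: "\<And>n. 0 \<le> a n" and "1 \<le> W"
    and inc: "(\<lambda>n. a (n + W) - a n) \<longlonglongrightarrow> 0"
  shows "(\<lambda>n. a n / real n) \<longlonglongrightarrow> 0"
proof (rule order_tendstoI)
  show "\<forall>\<^sub>F n in sequentially. b < a n / real n" if "b < 0" for b
    using that nn by (intro always_eventually allI) (meson divide_nonneg_nonneg less_le_trans of_nat_0_le_iff)
  fix e :: real assume "0 < e"
  then obtain m where m: "\<And>n. n \<ge> m \<Longrightarrow> a (n + W) - a n < e / 2"
    using order_tendstoD(2)[OF inc, of "e / 2"] unfolding eventually_sequentially by auto
  have steps: "a (m + j * W) \<le> a m + real j * (e / 2)" for j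
  proof (induction j)
    case (Suc j)
    have "a (m + j * W + W) - a (m + j * W) < e / 2" by (rule m) simp
    then have "a (m + j * W + W) \<le> a m + real j * (e / 2) + e / 2" using Suc by linarith
    moreover have "m + j * W + W = m + Suc j * W" by simp
    ultimately show ?case by (simp only: of_nat_Suc distrib_right mult_1_left)
  qed simp
  have bound: "a n \<le> a m + e / 2 + real n * (e / 2)" for n
  proof -
    \<comment> \<open>Starting from \<open>m\<close>, \<open>n + 1\<close> steps of length
      \<open>W \<ge> 1\<close> overshoot \<open>n\<close>; the surplus step costs only a
      constant.\<close>
    have "n \<le> Suc n * W" using \<open>1 \<le> W\<close> by (metis le_trans le_SucI le_refl mult.right_neutral mult_le_mono2)
    then have "a n \<le> a (m + Suc n * W)" by (intro mono) simp
    also have "\<dots> \<le> a m + real (Suc n) * (e / 2)" by (rule steps)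
    finally show ?thesis by (simp add: algebra_simps add_divide_distrib)
  qed
  have "((\<lambda>n. (a m + e / 2) / real n) \<longlongrightarrow> 0) sequentially"
    by (intro tendsto_divide_0[OF tendsto_const] filterlim_compose[OF _ filterlim_real_sequentially]
        filterlim_at_top_imp_at_infinity filterlim_real_sequentially)
  then have "\<forall>\<^sub>F n in sequentially. (a m + e / 2) / real n < e / 2"
    using \<open>0 < e\<close> by (intro order_tendstoD(2)) auto
  then show "\<forall>\<^sub>F n in sequentially. a n / real n < e"
    using eventually_gt_at_top[of 0]
  proof eventually_elim
    case (elim n)
    have "a n / real n \<le> (a m + e / 2 + real n * (e / 2)) / real n"
      by (intro divide_right_mono bound) simp
    also have "\<dots> = (a m + e / 2) / real n + e / 2"
      using elim(2) by (simp only: add_divide_distrib) simp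
    finally show ?case using elim(1) by linarith
  qed
qed

context permutative_ca
begin

text \<open>A word of length \<open>n + (s - r)\<close> of \<open>x\<close> amounts to a word of length \<open>s - r\<close> inside it and a word of
  length \<open>n\<close> of \<open>F x\<close>, so the increments of the word entropy are conditional entropies given \<open>F x\<close>.\<close>

lemma word_entropy_sublinear:
  assumes "prob_space \<mu>" and sets: "sets \<mu> = sets borel"
    and Fp: "preserves_measure \<mu> F" and \<sigma>: "preserves_measure \<mu> shift_map"
    and E: "E \<in> sets \<mu>" "measure \<mu> E = 1" "inj_on F E"
  shows "(\<lambda>n. ent \<mu> (\<lambda>x. restrict x {0..<int n}) / real n) \<longlonglongrightarrow> 0"
proof (rule sublinear_of_increments)
  interpret prob_space \<mu> by fact
  let ?a = "\<lambda>n. ent \<mu> (\<lambda>x. restrict x {0..<int n})"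
  have word: "simple_function \<mu> (\<lambda>x. restrict x {c..<d :: int})" for c d
    by (rule simple_function_word[OF sets]) simp
  show "?a m \<le> ?a n" if "m \<le> n" for m n
    by (rule ent_mono[OF word word]) (use that in \<open>auto simp: restrict_eq_iff\<close>)
  show "0 \<le> ?a n" for n by (rule ent_nonneg[OF word])
  define W where "W = nat (s - r)"
  show "1 \<le> W" using rs by (simp add: W_def)
  have W: "int W = s - r" using rs by (simp add: W_def)
  \<comment> \<open>The window is centered so that it eventually contains every cylinder window
    around 0, while the word on \<open>[0, W)\<close> stays inside it.\<close>
  define p where "p n = - int (n div 2)" for n
  define X where "X x = restrict x {0..<int W}" for x :: "int \<Rightarrow> 'a"
  define Y where "Y n x = restrict (F x) {p n - r..<p n - r + int n}" for n x
  have X: "simple_function \<mu> X" unfolding X_def[abs_def] by (rule word)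
  have Y: "simple_function \<mu> (Y n)" for n
    unfolding Y_def[abs_def] by (rule simple_function_preserves[OF Fp word])
  have pn: "p n \<le> 0" "0 \<le> p n + int n" for n by (simp_all add: p_def)
  have "?a (n + W) - ?a n = cond_ent \<mu> X (Y n)" for n
  proof -
    have "?a (n + W) = ent \<mu> (\<lambda>x. restrict x {p n..<p n + int (n + W)})"
      by (rule ent_word_translate[OF sets \<sigma>, symmetric])
    also have "\<dots> = ent \<mu> (\<lambda>x. (X x, Y n x))"
    proof (rule ent_cong)
      fix x y :: "int \<Rightarrow> 'a"
      have "(\<forall>i\<in>{p n..<p n + int (n + W)}. x i = y i) \<longleftrightarrow>
        (\<forall>i\<in>{0..<int W}. x i = y i) \<and> (\<forall>i\<in>{p n - r..<p n - r + int n}. F x i = F y i)" (is "?l \<longleftrightarrow> ?r")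
      proof
        assume l: ?l
        have "F x m = F y m" if "m \<in> {p n - r..<p n - r + int n}" for m
        proof (rule local)
          fix i assume "m + r \<le> i" "i \<le> m + s"
          then have "i \<in> {p n..<p n + int (n + W)}" using that W by auto
          then show "x i = y i" using l by blast
        qed
        moreover have "x i = y i" if "i \<in> {0..<int W}" for i
        proof -
          have "i \<in> {p n..<p n + int (n + W)}" using that pn[of n] by auto
          then show ?thesis using l by blast
        qed
        ultimately show ?r by blast
      next
        \<comment> \<open>From the word on \<open>[0, W)\<close> the agreement is extended left to
          \<open>p n\<close>; the window of length \<open>s - r\<close> beginning there is then
          extended right over all \<open>n\<close> image letters.\<close>
        assume r': ?r
        have base: "x i = y i" if "0 \<le> i" "i < 0 + (s - r)" for i using r' that W by simp
        have im: "F x m = F y m" if "p n - r \<le> m" "m < p n - r + int n" for m using r' that by simp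
        have left: "x i = y i" if "p n \<le> i" "i < s - r" for i
        proof (rule extend_left[of 0 x y "n div 2" i])
          show "F x m = F y m" if "0 - r - int (n div 2) \<le> m" "m < 0 - r" for m
            by (rule im) (use that pn(2)[of n] in \<open>simp_all add: p_def\<close>)
        qed (use base that in \<open>simp_all add: p_def\<close>)
        have "x i = y i" if "p n \<le> i" "i < p n + int (n + W)" for i
        proof (rule extend_right[of "p n" x y n i])
          show "x i = y i" if "p n \<le> i" "i < p n + (s - r)" for i
            by (rule left) (use that pn(1)[of n] in linarith)+
        qed (use im that W in simp_all)
        then show ?l by simp
      qed
      then show "restrict x {p n..<p n + int (n + W)} = restrict y {p n..<p n + int (n + W)} \<longleftrightarrow>
          (X x, Y n x) = (X y, Y n y)"
        by (simp only: X_def Y_def restrict_eq_iff prod.inject)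
    qed
    also have "\<dots> - ent \<mu> (Y n) = cond_ent \<mu> X (Y n)" by (simp add: cond_ent_def)
    \<comment> \<open>Invariance under \<open>F\<close>, followed by invariance under the shift,
      turns a word of \<open>F x\<close> into a word of \<open>x\<close> of the same length.\<close>
    also have "ent \<mu> (Y n) = ent \<mu> (\<lambda>x. restrict x {p n - r..<p n - r + int n})"
      unfolding Y_def[abs_def] by (rule ent_preserves[OF Fp word])
    also have "\<dots> = ?a n" by (rule ent_word_translate[OF sets \<sigma>])
    finally show ?thesis .
  qed
  moreover have "(\<lambda>n. cond_ent \<mu> X (Y n)) \<longlonglongrightarrow> 0"
  proof (rule cond_ent_tendsto_0[OF X Y])
    fix e :: real assume "0 < e"
    have "X x = X y" if "x \<in> E" "y \<in> E" "F x = F y" for x y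
      using inj_onD[OF E(3) that(3) that(1,2)] by simp
    from approx_factor[OF \<open>prob_space \<mu>\<close> sets X continuous E(1,2) this \<open>0 < e\<close>]
    obtain k A where A: "A \<in> events" "1 - e < prob A"
      "\<And>x y. x \<in> A \<Longrightarrow> y \<in> A \<Longrightarrow> F y \<in> cyl k (F x) \<Longrightarrow> X x = X y"
      by blast
    show "\<forall>\<^sub>F n in sequentially. \<exists>A\<in>events. 1 - e < prob A \<and> (\<forall>x\<in>A. \<forall>y\<in>A. Y n x = Y n y \<longrightarrow> X x = X y)"
      \<comment> \<open>The image window then contains \<open>[-k, k]\<close>: \<open>|r|\<close>
        absorbs the offset and the extra 1 the half-open right end.\<close>
      using eventually_ge_at_top[of "2 * (k + nat \<bar>r\<bar> + 1)"]
    proof eventually_elim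
      case (elim n)
      have half: "k + nat \<bar>r\<bar> + 1 \<le> n div 2" using div_le_mono[OF elim, of 2] by simp
      have "2 * (n div 2) \<le> n" by simp
      with half have "int k + \<bar>r\<bar> + 1 \<le> int (n div 2)" "2 * int (n div 2) \<le> int n" by linarith+
      then have win: "{- int k..int k} \<subseteq> {p n - r..<p n - r + int n}"
        by (auto simp: p_def)
      have "X x = X y" if "x \<in> A" "y \<in> A" "Y n x = Y n y" for x y
      proof (rule A(3)[OF that(1,2)])
        have "\<forall>i\<in>{p n - r..<p n - r + int n}. F x i = F y i"
          using that(3) by (simp only: Y_def restrict_eq_iff)
        then show "F y \<in> cyl k (F x)" using win unfolding cyl_def by fastforce
      qed
      then show ?case using A(1,2) by blast
    qed
  qed
  ultimately show "(\<lambda>n. ?a (n + W) - ?a n) \<longlonglongrightarrow> 0" by (simp only:)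
qed

lemma funpow_local:
  assumes "R \<ge> \<bar>r\<bar>" "R \<ge> \<bar>s\<bar>"
    and "\<And>i. m - int n * R \<le> i \<Longrightarrow> i \<le> m + int n * R \<Longrightarrow> x i = y i"
  shows "(F ^^ n) x m = (F ^^ n) y m"
  using assms(3)
proof (induction n arbitrary: m)
  case (Suc n)
  have "F ((F ^^ n) x) m = F ((F ^^ n) y) m"
  proof (rule local, rule Suc.IH)
    fix i j assume i: "m + r \<le> i" "i \<le> m + s" and j: "i - int n * R \<le> j" "j \<le> i + int n * R"
    have "int (Suc n) * R = int n * R + R" by (simp add: distrib_right)
    then have "m - int (Suc n) * R \<le> j" "j \<le> m + int (Suc n) * R" using i j assms(1,2) by linarith+
    then show "x j = y j" by (rule Suc.prems)
  qed
  then show ?case by simp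
qed simp

text \<open>Finite partitions are approximated by cylinder partitions. The itinerary of a cylinder
  partition over \<open>n\<close> steps of \<open>F\<close> is a function of a word of
  \<open>x\<close> of length linear in \<open>n\<close>, and word entropy is sublinear.\<close>

lemma ks_entropy_le_0:
  assumes "prob_space \<mu>" and sets: "sets \<mu> = sets borel"
    and Fp: "preserves_measure \<mu> F" and \<sigma>: "preserves_measure \<mu> shift_map"
    and E: "E \<in> sets \<mu>" "measure \<mu> E = 1" "inj_on F E"
  shows "ks_entropy \<mu> F \<le> 0"
  unfolding ks_entropy_def
proof (rule SUP_least)
  interpret prob_space \<mu> by fact
  have sp: "space \<mu> = UNIV" using sets_eq_imp_space_eq[OF sets] by simp
  fix P assume "P \<in> Collect (finite_measurable_partition \<mu>)"
  then have P: "finite_measurable_partition \<mu> P" by simp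
  define Y where "Y l x = restrict x {- int l..int l}" for l and x :: "int \<Rightarrow> 'a"
  have Y: "simple_function \<mu> (Y l)" for l
    unfolding Y_def[abs_def] by (rule simple_function_word[OF sets]) simp
  have C: "simple_function \<mu> (cell P)" by (rule simple_function_cell[OF P])
  have "entropy_wrt_partition \<mu> F P = 0"
  proof (rule entropy_wrt_partition_eq_0[OF Fp P Y])
    show "(\<lambda>l. cond_ent \<mu> (cell P) (Y l)) \<longlonglongrightarrow> 0"
    proof (rule cond_ent_tendsto_0[OF C Y])
      fix e :: real assume "0 < e"
      have U: "UNIV \<in> sets \<mu>" "measure \<mu> UNIV = 1" using sets prob_space by (simp_all add: sp)
      have "\<exists>n A. A \<in> sets \<mu> \<and> measure \<mu> A > 1 - e \<and>
          (\<forall>x\<in>A. \<forall>y\<in>A. y \<in> cyl n x \<longrightarrow> cell P x = cell P y)"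
        \<comment> \<open>With the identity as the factor, this says that a partition is nearly
          determined by a finite window.\<close>
        using approx_factor[OF \<open>prob_space \<mu>\<close> sets C continuous_on_id U _ \<open>0 < e\<close>] by simp
      then obtain k A where A: "A \<in> events" "1 - e < prob A"
        "\<And>x y. x \<in> A \<Longrightarrow> y \<in> A \<Longrightarrow> y \<in> cyl k x \<Longrightarrow> cell P x = cell P y"
        by blast
      show "\<forall>\<^sub>F n in sequentially. \<exists>A\<in>events. 1 - e < prob A \<and>
          (\<forall>x\<in>A. \<forall>y\<in>A. Y n x = Y n y \<longrightarrow> cell P x = cell P y)"
        using eventually_ge_at_top[of k]
      proof eventually_elim
        case (elim n)
        have "cell P x = cell P y" if "x \<in> A" "y \<in> A" "Y n x = Y n y" for x y
        proof (rule A(3)[OF that(1,2)])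
          have "\<forall>i\<in>{- int n..int n}. x i = y i" using that(3) by (simp only: Y_def restrict_eq_iff)
          then have "y \<in> cyl n x" by (simp add: cyl_def)
          then show "y \<in> cyl k x" using cyl_mono[OF elim] by blast
        qed
        then show ?case using A(1,2) by blast
      qed
    qed
    show "(\<lambda>n. ent \<mu> (\<lambda>x. map (\<lambda>i. Y l ((F ^^ i) x)) [0..<n]) / real n) \<longlonglongrightarrow> 0" for l
    proof -
      define R where "R = nat (\<bar>r\<bar> + \<bar>s\<bar>)"
      have R: "int R = \<bar>r\<bar> + \<bar>s\<bar>" "R \<ge> 1" using rs by (auto simp: R_def)
      \<comment> \<open>The length of the window from \<open>- l - n * R\<close> to
        \<open>l + n * R\<close>, which determines \<open>(F ^^ i) x\<close> on
        \<open>[-l, l]\<close> for all \<open>i < n\<close>.\<close>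
      define N where "N n = 2 * l + 1 + 2 * n * R" for n
      let ?a = "\<lambda>n. ent \<mu> (\<lambda>x. restrict x {0..<int n})"
      let ?L = "\<lambda>n. ent \<mu> (\<lambda>x. map (\<lambda>i. Y l ((F ^^ i) x)) [0..<n])"
      have YF: "simple_function \<mu> (\<lambda>x. Y l ((F ^^ i) x))" for i
        by (rule simple_function_preserves[OF preserves_measure_funpow[OF Fp] Y])
      have le: "?L n \<le> ?a (N n)" for n
      proof -
        define c where "c = - int l - int n * int R"
        have cN: "c + int (N n) = int l + int n * int R + 1"
          by (simp add: c_def N_def algebra_simps)
        have "?L n \<le> ent \<mu> (\<lambda>x. restrict x {c..<c + int (N n)})"
        proof (rule ent_mono[OF simple_function_word[OF sets] simple_function_map[OF YF]])
          fix x y :: "int \<Rightarrow> 'a"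
          assume "restrict x {c..<c + int (N n)} = restrict y {c..<c + int (N n)}"
          then have xy: "x j = y j" if "c \<le> j" "j < c + int (N n)" for j
            using that by (auto simp: restrict_eq_iff)
          have "(F ^^ i) x m = (F ^^ i) y m" if "i < n" "- int l \<le> m" "m \<le> int l" for i m
          proof (rule funpow_local[where R="int R"])
            fix j assume j: "m - int i * int R \<le> j" "j \<le> m + int i * int R"
            have "int i * int R \<le> int n * int R" using that(1) by (intro mult_right_mono) auto
            then show "x j = y j" using j that cN c_def by (intro xy) linarith+
          qed (use R in auto)
          then show "map (\<lambda>i. Y l ((F ^^ i) x)) [0..<n] = map (\<lambda>i. Y l ((F ^^ i) y)) [0..<n]"
            by (intro map_cong refl) (simp add: Y_def restrict_eq_iff)
        qed simp
        also have "\<dots> = ?a (N n)" by (rule ent_word_translate[OF sets \<sigma>])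
        finally show ?thesis .
      qed
      have "n \<le> N n" for n
      proof -
        have "n * 1 \<le> n * R" using R(2) by (rule mult_le_mono2)
        then show ?thesis unfolding N_def by linarith
      qed
      then have "filterlim N at_top sequentially"
        by (intro filterlim_at_top_mono[OF filterlim_ident] always_eventually allI)
      then have "(\<lambda>n. ?a (N n) / real (N n)) \<longlonglongrightarrow> 0"
        by (rule filterlim_compose[OF word_entropy_sublinear[OF assms]])
      then have "(\<lambda>n. ?a (N n) / real (N n) * real (2 * l + 1 + 2 * R)) \<longlonglongrightarrow> 0"
        by (rule tendsto_mult_left_zero)
      then show ?thesis
      proof (rule Lim_null_comparison[rotated])
        show "\<forall>\<^sub>F n in sequentially. norm (?L n / real n) \<le> ?a (N n) / real (N n) * real (2 * l + 1 + 2 * R)"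
          using eventually_ge_at_top[of 1]
        proof eventually_elim
          case (elim n)
          have nn: "0 \<le> ?L n" "0 \<le> ?a (N n)"
            by (intro ent_nonneg simple_function_map YF simple_function_word[OF sets]; simp)+
          have "N n \<le> (2 * l + 1 + 2 * R) * n"
          proof -
            have "(2 * l + 1) * 1 \<le> (2 * l + 1) * n" using elim by (rule mult_le_mono2)
            then show ?thesis by (simp add: N_def algebra_simps)
          qed
          then have "real (N n) \<le> real ((2 * l + 1 + 2 * R) * n)" by (rule of_nat_mono)
          then have Nn: "real (N n) \<le> real (2 * l + 1 + 2 * R) * real n" by (simp only: of_nat_mult)
          have pos: "0 < real (N n)" unfolding of_nat_0_less_iff N_def by simp
          have "?L n / real n \<le> ?a (N n) / real n" by (intro divide_right_mono le) simp
          also have "\<dots> = ?a (N n) / real (N n) * (real (N n) / real n)" using pos by simp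
          also have "\<dots> \<le> ?a (N n) / real (N n) * real (2 * l + 1 + 2 * R)"
            using nn pos Nn elim by (intro mult_left_mono) (simp_all add: pos_divide_le_eq)
          finally show ?case using nn by simp
        qed
      qed
    qed
  qed
  then show "ereal (entropy_wrt_partition \<mu> F P) \<le> 0" by simp
qed

end

subsection \<open>Ergodic measures are equal or mutually singular\<close>

text \<open>A positive set, in the sense of Hahn, of the signed measure
  \<open>M - N\<close>.\<close>

definition dominates :: "'x measure \<Rightarrow> 'x measure \<Rightarrow> 'x set \<Rightarrow> bool" where
  "dominates M N A \<longleftrightarrow> A \<in> sets M \<and> (\<forall>X\<in>sets M. X \<subseteq> A \<longrightarrow> emeasure N X \<le> emeasure M X)"

lemma dominates_UN:
  fixes A :: "nat \<Rightarrow> 'x set"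
  assumes "\<And>n. dominates M N (A n)" and s: "sets N = sets M"
  shows "dominates M N (\<Union>n. A n)"
proof -
  have A: "A n \<in> sets M" for n using assms(1) by (simp add: dominates_def)
  have "emeasure N X \<le> emeasure M X" if X: "X \<in> sets M" "X \<subseteq> (\<Union>n. A n)" for X
  proof -
    define B where "B n = X \<inter> disjointed A n" for n
    have B: "B n \<in> sets M" for n
      unfolding B_def using sets.range_disjointed_sets[of A M] A X by blast
    have un: "(\<Union>n. B n) = X"
      unfolding B_def using X(2) UN_disjointed_eq[of A] by blast
    have disj: "disjoint_family B"
      using disjoint_family_disjointed[of A] unfolding B_def disjoint_family_on_def by blast
    have "B n \<subseteq> A n" for n unfolding B_def using disjointed_subset[of A n] by blast
    then have le: "emeasure N (B n) \<le> emeasure M (B n)" for n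
      using assms(1)[of n] B by (simp add: dominates_def)
    have "emeasure N X = (\<Sum>n. emeasure N (B n))"
      using suminf_emeasure[of B N] B disj s un by (simp add: image_subset_iff)
    also have "\<dots> \<le> (\<Sum>n. emeasure M (B n))" by (intro suminf_le le) auto
    also have "\<dots> = emeasure M X"
      using suminf_emeasure[of B M] B disj un by (simp add: image_subset_iff)
    finally show ?thesis .
  qed
  then show ?thesis using A by (simp add: dominates_def)
qed

text \<open>The inequality for the complement is the reverse inequality, since both total masses are
  1.\<close>

lemma prob_measures_eq_of_le:
  assumes "prob_space M" "prob_space N" and s: "sets N = sets M"
    and le: "\<And>X. X \<in> sets M \<Longrightarrow> measure M X \<le> measure N X"
  shows "M = N"
proof (rule measure_eqI)
  interpret M: prob_space M by fact
  interpret N: prob_space N by fact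
  fix X assume X: "X \<in> sets M"
  have "measure M (space M - X) \<le> measure N (space M - X)"
    using X by (intro le) auto
  then have "measure N X \<le> measure M X"
    using X s M.prob_compl[of X] N.prob_compl[of X] sets_eq_imp_space_eq[OF s] by simp
  then show "emeasure M X = emeasure N X"
    using le[OF X] by (simp add: M.emeasure_eq_measure N.emeasure_eq_measure)
qed (use s in simp)

text \<open>A Hahn set for the difference of two invariant measures can be saturated to an invariant set,
  on which both measures are trivial by ergodicity.\<close>

lemma ergodic_eq_or_singular:
  assumes "prob_space M" "prob_space N" and s: "sets N = sets M" and sp: "space M = UNIV"
    and T: "ergodic M T" "ergodic N T"
    and inv: "\<And>x. T' (T x) = x" "\<And>x. T (T' x) = x" and T'm: "T' \<in> M \<rightarrow>\<^sub>M M"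
  shows "M = N \<or> (\<exists>E\<in>sets M. measure M E = 1 \<and> measure N E = 0)"
proof -
  interpret M: prob_space M by fact
  interpret N: prob_space N by fact
  have spN: "space N = UNIV" using sets_eq_imp_space_eq[OF s] sp by simp
  have Tm: "T \<in> M \<rightarrow>\<^sub>M M" using T(1) by (simp add: ergodic_def preserves_measure_def)
  have vT: "T -` A \<in> sets M" "T' -` A \<in> sets M" if "A \<in> sets M" for A
    using measurable_sets[OF Tm that] measurable_sets[OF T'm that] sp by simp_all
  have pres: "emeasure M (T -` A) = emeasure M A" "emeasure N (T -` A) = emeasure N A" if "A \<in> sets M" for A
    using T that s by (simp_all add: ergodic_def preserves_measure_def sp spN)
  have domT: "dominates M N (T -` A)" if A: "dominates M N A" for A
    unfolding dominates_def
  proof (intro conjI ballI impI)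
    show "T -` A \<in> sets M" using A vT by (simp add: dominates_def)
    fix X assume X: "X \<in> sets M" "X \<subseteq> T -` A"
    have XT: "X = T -` (T' -` X)" using inv by auto
    have "T' -` X \<subseteq> A" using X(2) inv by (metis subsetI subsetD vimageE vimageI2)
    then have "emeasure N (T' -` X) \<le> emeasure M (T' -` X)"
      using A vT(2)[OF X(1)] by (simp add: dominates_def)
    then show "emeasure N X \<le> emeasure M X"
      using pres[OF vT(2)[OF X(1)]] XT by metis
  qed
  have domT': "dominates M N (T' -` A)" if A: "dominates M N A" for A
    unfolding dominates_def
  proof (intro conjI ballI impI)
    show "T' -` A \<in> sets M" using A vT by (simp add: dominates_def)
    fix X assume X: "X \<in> sets M" "X \<subseteq> T' -` A"
    have "T -` X \<subseteq> A" using X(2) inv by (metis subsetI subsetD vimageE vimageI2)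
    then have "emeasure N (T -` X) \<le> emeasure M (T -` X)"
      using A vT(1)[OF X(1)] by (simp add: dominates_def)
    then show "emeasure N X \<le> emeasure M X" using pres[OF X(1)] by simp
  qed
  obtain Y where Y: "Y \<in> sets M" "\<And>X. X \<in> sets M \<Longrightarrow> X \<subseteq> Y \<Longrightarrow> emeasure N X \<le> emeasure M X"
    "\<And>X. X \<in> sets M \<Longrightarrow> X \<inter> Y = {} \<Longrightarrow> emeasure M X \<le> emeasure N X"
    using finite_unsigned_Hahn_decomposition[OF M.finite_measure_axioms N.finite_measure_axioms s]
    by metis
  \<comment> \<open>\<open>Z\<close> collects the points whose forward orbit meets \<open>Y\<close>,
    so its preimage lies in \<open>Z\<close>; saturation under the inverse in \<open>U\<close> turns
    this inclusion into the strict invariance that \<open>ergodic\<close> asks for. Domination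
    survives both steps because both measures are invariant.\<close>
  define Z where "Z = (\<Union>n. (T ^^ n) -` Y)"
  define U where "U = (\<Union>n. (T' ^^ n) -` Z)"
  have "dominates M N ((T ^^ n) -` Y)" for n
  proof (induction n)
    case 0
    then show ?case using Y(1,2) by (simp add: dominates_def)
  next
    case (Suc n)
    from domT[OF this] show ?case by (simp add: vimage_def funpow_swap1)
  qed
  then have Z: "dominates M N Z" unfolding Z_def by (rule dominates_UN[OF _ s])
  have "dominates M N ((T' ^^ n) -` Z)" for n
  proof (induction n)
    case (Suc n)
    from domT'[OF this] show ?case by (simp add: vimage_def funpow_swap1)
  qed (use Z in simp)
  then have U: "dominates M N U" unfolding U_def by (rule dominates_UN[OF _ s])
  then have Us: "U \<in> sets M" by (simp add: dominates_def)
  have "T -` U = U"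
  proof (intro subset_antisym subsetI)
    fix x assume "x \<in> T -` U"
    then obtain n where n: "(T' ^^ n) (T x) \<in> Z" by (auto simp: U_def)
    show "x \<in> U"
    proof (cases n)
      case 0
      then obtain m where "(T ^^ m) (T x) \<in> Y" using n by (auto simp: Z_def)
      then have "(T ^^ Suc m) x \<in> Y" by (simp add: funpow_swap1)
      then have "x \<in> Z" unfolding Z_def by blast
      then have "(T' ^^ 0) x \<in> Z" by simp
      then show ?thesis unfolding U_def by blast
    next
      case (Suc m)
      then have "(T' ^^ m) x \<in> Z" using n inv(1) by (simp add: funpow_swap1)
      then show ?thesis unfolding U_def by blast
    qed
  next
    fix x assume "x \<in> U"
    then obtain n where "(T' ^^ n) x \<in> Z" by (auto simp: U_def)
    then have "(T' ^^ Suc n) (T x) \<in> Z" using inv(1) by (simp add: funpow_swap1)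
    then show "x \<in> T -` U" unfolding U_def by blast
  qed
  then have triv: "measure M U = 0 \<or> measure M U = 1" "measure N U = 0 \<or> measure N U = 1"
    using T Us s by (simp_all add: ergodic_def sp spN)
  have "Y \<subseteq> Z" unfolding Z_def using funpow.simps(1)[of T] by (metis UN_upper UNIV_I id_apply vimage_id)
  moreover have "Z \<subseteq> U" unfolding U_def using funpow.simps(1)[of T'] by (metis UN_upper UNIV_I id_apply vimage_id)
  ultimately have YU: "Y \<subseteq> U" by blast
  have in_U: "measure N X \<le> measure M X" if "X \<in> sets M" "X \<subseteq> U" for X
    using U that by (simp add: dominates_def M.emeasure_eq_measure N.emeasure_eq_measure)
  have out_U: "measure M X \<le> measure N X" if X: "X \<in> sets M" "X \<inter> U = {}" for X
  proof -
    have "X \<inter> Y = {}" using X(2) YU by blast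
    from Y(3)[OF X(1) this] show ?thesis by (simp add: M.emeasure_eq_measure N.emeasure_eq_measure)
  qed
  \<comment> \<open>The fourth combination, mass 0 for \<open>M\<close> and mass 1 for
    \<open>N\<close>, is excluded by domination on \<open>U\<close>.\<close>
  consider "measure M U = 1" "measure N U = 0" | "measure M U = 1" "measure N U = 1"
    | "measure M U = 0" "measure N U = 0"
    using triv in_U[OF Us] by fastforce
  then show ?thesis
  proof cases
    case 1
    then show ?thesis using Us by blast
  next
    case 2
    have AE: "AE x in M. x \<in> U" "AE x in N. x \<in> U"
      using 2 Us s by (simp_all add: M.prob_eq_1 N.prob_eq_1)
    have le: "measure N X \<le> measure M X" if X: "X \<in> sets M" for X
    proof -
      have "measure N X = measure N (X \<inter> U)"
        by (rule N.finite_measure_eq_AE) (use AE X Us s in auto)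
      also have "\<dots> \<le> measure M (X \<inter> U)" using X Us by (intro in_U) auto
      also have "\<dots> \<le> measure M X" using X Us by (intro M.finite_measure_mono) auto
      finally show ?thesis .
    qed
    have "N = M" by (rule prob_measures_eq_of_le[OF assms(2,1)]) (use s le in simp_all)
    then show ?thesis by blast
  next
    case 3
    have AE: "AE x in M. x \<notin> U" "AE x in N. x \<notin> U"
      using 3 Us s by (simp_all add: M.prob_eq_0 N.prob_eq_0)
    have le: "measure M X \<le> measure N X" if X: "X \<in> sets M" for X
    proof -
      have "measure M X = measure M (X - U)"
        by (rule M.finite_measure_eq_AE) (use AE X Us s in auto)
      also have "\<dots> \<le> measure N (X - U)" using X Us by (intro out_U) auto
      also have "\<dots> \<le> measure N X" using X Us s by (intro N.finite_measure_mono) auto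
      finally show ?thesis .
    qed
    have "M = N" by (rule prob_measures_eq_of_le[OF assms(1,2) s le])
    then show ?thesis by blast
  qed
qed

subsection \<open>Translates of an invariant measure\<close>

definition unshift_map :: "(int \<Rightarrow> 'a) \<Rightarrow> (int \<Rightarrow> 'a)" where
  "unshift_map x = (\<lambda>i. x (i - 1))"

lemma unshift_shift [simp]: "unshift_map (shift_map x) = x" "shift_map (unshift_map x) = x"
  by (simp_all add: unshift_map_def shift_map_def)

lemma continuous_unshift_map: "continuous_on UNIV (unshift_map :: (int \<Rightarrow> 'a::topological_space) \<Rightarrow> _)"
  unfolding unshift_map_def
  by (intro continuous_on_coordinatewise_then_product continuous_on_product_coordinates)

locale permutative_algebraic_ca = permutative_ca F r s
  for F :: "(int \<Rightarrow> 'a::alphabet) \<Rightarrow> (int \<Rightarrow> 'a)" and r s +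
  fixes G :: "(int \<Rightarrow> 'a) monoid" (structure)
  assumes shift_group: "abelian_group_shift G" and F_hom: "F \<in> hom G G"
begin

sublocale comm_group G
  using shift_group by (simp add: abelian_group_shift_def)

lemma carrier_UNIV [simp]: "carrier G = UNIV"
  using shift_group by (simp add: abelian_group_shift_def)

lemma F_mult: "F (x \<otimes> y) = F x \<otimes> F y"
  using hom_mult[OF F_hom] by simp

lemma F_one: "F \<one> = \<one>"
  using hom_one[OF F_hom] is_group by simp

lemma continuous_mult: "continuous_on UNIV (\<lambda>(x, y). x \<otimes> y)"
  and continuous_shift: "continuous_on UNIV (shift_map :: (int \<Rightarrow> 'a) \<Rightarrow> _)"
  and shift_hom: "shift_map \<in> hom G G"
  using shift_group by (auto simp: abelian_group_shift_def)

lemma shift_mult: "shift_map (x \<otimes> y) = shift_map x \<otimes> shift_map y"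
  using hom_mult[OF shift_hom] by simp

lemma shift_one: "shift_map \<one> = \<one>"
  using hom_one[OF shift_hom] is_group by simp

lemma unshift_mult: "unshift_map (x \<otimes> y) = unshift_map x \<otimes> unshift_map y"
  using shift_mult[of "unshift_map x" "unshift_map y"] by (metis unshift_shift)

lemma continuous_translation: "continuous_on UNIV (\<lambda>x. d \<otimes> x)" "continuous_on UNIV (\<lambda>x. x \<otimes> d)"
proof -
  have "continuous_on UNIV (\<lambda>x. (d, x))" "continuous_on UNIV (\<lambda>x. (x, d))"
    by (intro continuous_on_Pair continuous_on_const continuous_on_id)+
  then show "continuous_on UNIV (\<lambda>x. d \<otimes> x)" "continuous_on UNIV (\<lambda>x. x \<otimes> d)"
    using continuous_on_compose2[OF continuous_mult, of UNIV "\<lambda>x. (d, x)"]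
      continuous_on_compose2[OF continuous_mult, of UNIV "\<lambda>x. (x, d)"]
    by simp_all
qed

lemma borel_maps [measurable]:
  "(\<lambda>x. d \<otimes> x) \<in> borel_measurable borel" "F \<in> borel_measurable borel"
  "shift_map \<in> borel_measurable (borel :: (int \<Rightarrow> 'a) measure)"
  "unshift_map \<in> borel_measurable (borel :: (int \<Rightarrow> 'a) measure)"
  by (intro borel_measurable_continuous_onI continuous_translation continuous continuous_shift
      continuous_unshift_map)+

text \<open>Written with image measures, so that translations compose through
  \<open>distr_distr\<close>.\<close>

definition stab :: "(int \<Rightarrow> 'a) measure \<Rightarrow> (int \<Rightarrow> 'a) set" where
  "stab \<mu> = {d. distr \<mu> borel (\<lambda>x. d \<otimes> x) = \<mu>}"

abbreviation Ker :: "(int \<Rightarrow> 'a) set" where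
  "Ker \<equiv> kernel G G F"

lemma Ker_iff: "d \<in> Ker \<longleftrightarrow> F d = \<one>"
  by (simp add: kernel_def)

lemma F_eq_iff: "F x = F y \<longleftrightarrow> x \<otimes> inv y \<in> Ker"
proof -
  have "F x = F (x \<otimes> inv y) \<otimes> F y"
    by (simp add: F_mult[symmetric] m_assoc)
  then show ?thesis by (auto simp: Ker_iff)
qed

text \<open>All kernel elements have the same image, so \<open>image_determines\<close> recovers
  each from \<open>s - r\<close> letters.\<close>

lemma finite_Ker: "finite Ker"
proof (rule inj_on_finite)
  let ?I = "{0..<s - r}"
  show "inj_on (\<lambda>x. restrict x ?I) Ker"
  proof (rule inj_onI)
    fix x y assume x: "x \<in> Ker" and y: "y \<in> Ker" and "restrict x ?I = restrict y ?I"
    then have "\<forall>i\<in>?I. x i = y i" by (simp only: restrict_eq_iff)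
    then have "x i = y i" if "0 \<le> i" "i < 0 + (s - r)" for i using that by simp
    moreover have "F x = F y" using x y by (simp only: Ker_iff)
    ultimately show "x = y" by (rule image_determines)
  qed
  show "(\<lambda>x. restrict x ?I) ` Ker \<subseteq> PiE ?I (\<lambda>_. UNIV)" by auto
  show "finite (PiE ?I (\<lambda>_. UNIV :: 'a set))" by (intro finite_PiE) auto
qed

lemma shift_Ker: "shift_map ` Ker = Ker"
proof
  show "shift_map ` Ker \<subseteq> Ker" by (auto simp: Ker_iff commutes shift_one)
  show "Ker \<subseteq> shift_map ` Ker"
  proof
    fix d assume d: "d \<in> Ker"
    have "shift_map (F (unshift_map d)) = shift_map \<one>"
      using d by (simp only: commutes[symmetric] unshift_shift Ker_iff shift_one)
    from arg_cong[OF this, of unshift_map] have "F (unshift_map d) = \<one>"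
      by (simp only: unshift_shift)
    then show "d \<in> shift_map ` Ker" by (intro image_eqI[of _ _ "unshift_map d"]) (simp_all add: Ker_iff)
  qed
qed

text \<open>The orbit stays in a finite set, so two iterates agree; invertibility of the shift
  cancels the smaller one.\<close>

lemma shift_periodic_Ker:
  assumes "d \<in> Ker"
  obtains k where "k \<ge> 1" "(shift_map ^^ k) d = d"
proof -
  have mem: "(shift_map ^^ n) d \<in> Ker" for n
    using assms shift_Ker by (induction n) auto
  have "\<not> inj (\<lambda>n. (shift_map ^^ n) d)"
    using finite_imageD[of "\<lambda>n. (shift_map ^^ n) d" UNIV] finite_subset[OF _ finite_Ker] mem
    by (metis image_subsetI infinite_UNIV_nat)
  then obtain i j where ij: "i < j" "(shift_map ^^ i) d = (shift_map ^^ j) d"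
    unfolding inj_def using nat_neq_iff by metis
  have undo: "(unshift_map ^^ n) ((shift_map ^^ n) x) = x" for n and x :: "int \<Rightarrow> 'a"
    by (induction n) (simp_all add: funpow_swap1[of unshift_map])
  have "(shift_map ^^ j) d = (shift_map ^^ i) ((shift_map ^^ (j - i)) d)"
    using ij(1) fun_cong[OF funpow_add[of i "j - i" shift_map], of d] by simp
  then have "(shift_map ^^ (j - i)) d = d" using ij(2) undo by metis
  with ij(1) show thesis by (intro that[of "j - i"]) auto
qed

section \<open>The stabilizer of a measure under translations\<close>

context
  fixes \<mu> :: "(int \<Rightarrow> 'a) measure"
  assumes prob: "prob_space \<mu>" and sets_mu [measurable_cong]: "sets \<mu> = sets borel"
begin

interpretation prob_space \<mu> by (rule prob)

lemma space_mu: "space \<mu> = UNIV"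
  using sets_eq_imp_space_eq[OF sets_mu] by simp

lemma distr_self_iff:
  assumes T: "T \<in> borel_measurable borel"
  shows "distr \<mu> borel T = \<mu> \<longleftrightarrow> preserves_measure \<mu> T"
proof -
  have Tm: "T \<in> \<mu> \<rightarrow>\<^sub>M borel" "T \<in> \<mu> \<rightarrow>\<^sub>M \<mu>"
    using T by (simp_all add: measurable_cong_sets[OF sets_mu refl] measurable_cong_sets[OF sets_mu sets_mu])
  show ?thesis
  proof
    assume eq: "distr \<mu> borel T = \<mu>"
    have "emeasure \<mu> (T -` B \<inter> space \<mu>) = emeasure \<mu> B" if "B \<in> sets \<mu>" for B
      using emeasure_distr[OF Tm(1), of B] that eq sets_mu by simp
    then show "preserves_measure \<mu> T" using Tm by (simp add: preserves_measure_def)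
  next
    assume p: "preserves_measure \<mu> T"
    show "distr \<mu> borel T = \<mu>"
    proof (rule measure_eqI)
      show "emeasure (distr \<mu> borel T) B = emeasure \<mu> B" if "B \<in> sets (distr \<mu> borel T)" for B
        using emeasure_distr[OF Tm(1), of B] that p sets_mu by (simp add: preserves_measure_def)
    qed (simp add: sets_mu)
  qed
qed

lemma preserves_unshift:
  assumes "preserves_measure \<mu> shift_map"
  shows "preserves_measure \<mu> unshift_map"
proof -
  have eq: "distr \<mu> borel shift_map = \<mu>" using assms distr_self_iff[OF borel_maps(3)] by simp
  have "distr \<mu> borel unshift_map = distr (distr \<mu> borel shift_map) borel unshift_map"
    by (simp add: eq)
  also have "\<dots> = distr \<mu> borel (unshift_map \<circ> shift_map)"
    by (rule distr_distr) (auto simp: measurable_cong_sets[OF sets_mu refl])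
  also have "unshift_map \<circ> shift_map = (\<lambda>x :: int \<Rightarrow> 'a. x)" by auto
  also have "distr \<mu> borel (\<lambda>x. x) = \<mu>" by (rule distr_id2) (simp add: sets_mu)
  finally show ?thesis using distr_self_iff[OF borel_maps(4)] by simp
qed

lemma distr_mult: "distr \<mu> borel (\<lambda>x. (d \<otimes> e) \<otimes> x) = distr (distr \<mu> borel (\<lambda>x. e \<otimes> x)) borel (\<lambda>x. d \<otimes> x)"
proof -
  have "distr (distr \<mu> borel (\<lambda>x. e \<otimes> x)) borel (\<lambda>x. d \<otimes> x) = distr \<mu> borel ((\<lambda>x. d \<otimes> x) \<circ> (\<lambda>x. e \<otimes> x))"
    by (rule distr_distr) (auto simp: measurable_cong_sets[OF sets_mu refl])
  moreover have "(\<lambda>x. d \<otimes> x) \<circ> (\<lambda>x. e \<otimes> x) = (\<lambda>x. (d \<otimes> e) \<otimes> x)" by (auto simp: m_assoc)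
  ultimately show ?thesis by simp
qed

lemma distr_hom:
  assumes h: "h \<in> borel_measurable borel" and mult: "\<And>x y. h (x \<otimes> y) = h x \<otimes> h y"
  shows "distr (distr \<mu> borel (\<lambda>x. d \<otimes> x)) borel h = distr (distr \<mu> borel h) borel (\<lambda>x. h d \<otimes> x)"
proof -
  have "distr (distr \<mu> borel (\<lambda>x. d \<otimes> x)) borel h = distr \<mu> borel (h \<circ> (\<lambda>x. d \<otimes> x))"
    using h by (intro distr_distr) (auto simp: measurable_cong_sets[OF sets_mu refl])
  also have "h \<circ> (\<lambda>x. d \<otimes> x) = (\<lambda>x. h d \<otimes> x) \<circ> h" by (auto simp: mult)
  also have "distr \<mu> borel \<dots> = distr (distr \<mu> borel h) borel (\<lambda>x. h d \<otimes> x)"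
    using h by (intro distr_distr[symmetric]) (auto simp: measurable_cong_sets[OF sets_mu refl])
  finally show ?thesis .
qed

text \<open>Used with the shift and with its inverse, which together make the stabilizer strictly
  shift-invariant.\<close>

lemma stab_hom:
  assumes h: "h \<in> borel_measurable borel" and mult: "\<And>x y. h (x \<otimes> y) = h x \<otimes> h y"
    and "preserves_measure \<mu> h" "d \<in> stab \<mu>"
  shows "h d \<in> stab \<mu>"
  using distr_hom[OF h mult, of d] assms(3,4) distr_self_iff[OF h] by (simp add: stab_def)

lemma subgroup_stab: "subgroup (stab \<mu>) G"
proof (rule subgroupI)
  have "distr \<mu> borel (\<lambda>x. x) = \<mu>" by (rule distr_id2) (simp add: sets_mu)
  moreover have one: "(\<lambda>x. \<one> \<otimes> x) = (\<lambda>x. x)" by auto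
  ultimately have id: "distr \<mu> borel (\<lambda>x. \<one> \<otimes> x) = \<mu>" by (simp only:)
  then have "\<one> \<in> stab \<mu>" by (simp only: stab_def mem_Collect_eq)
  then show "stab \<mu> \<noteq> {}" by blast
  fix d assume d: "d \<in> stab \<mu>"
  have "distr \<mu> borel (\<lambda>x. inv d \<otimes> x) = distr (distr \<mu> borel (\<lambda>x. d \<otimes> x)) borel (\<lambda>x. inv d \<otimes> x)"
    using d by (simp add: stab_def)
  also have "\<dots> = distr \<mu> borel (\<lambda>x. (inv d \<otimes> d) \<otimes> x)" by (rule distr_mult[symmetric])
  also have "inv d \<otimes> d = \<one>" by simp
  also note id
  finally show "inv d \<in> stab \<mu>" by (simp add: stab_def)
  fix e assume "e \<in> stab \<mu>"
  then show "d \<otimes> e \<in> stab \<mu>" using d by (simp add: stab_def distr_mult)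
qed simp

end

end

section \<open>Measures invariant under the kernel\<close>

context permutative_algebraic_ca
begin

text \<open>The saturation is the union of the translates of the cylinder by kernel elements. They
  are disjoint because \<open>F\<close> is injective on the cylinder, and of equal mass because
  \<open>\<rho>\<close> is invariant under the kernel.\<close>

lemma measure_saturation_cyl:
  assumes "prob_space \<rho>" and s: "sets \<rho> = sets borel" and K: "Ker \<subseteq> stab \<rho>"
    and inj: "inj_on F (cyl n x)"
  shows "measure \<rho> (F -` F ` cyl n x) = real (card Ker) * measure \<rho> (cyl n x)"
proof -
  interpret prob_space \<rho> by fact
  let ?C = "cyl n x"
  have sp: "space \<rho> = UNIV" by (rule space_mu[OF assms(1) s])
  have eq: "F -` F ` ?C = (\<Union>k\<in>Ker. (\<lambda>y. k \<otimes> y) -` ?C)"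
  proof (intro subset_antisym subsetI)
    fix y assume "y \<in> F -` F ` ?C"
    then obtain c where c: "c \<in> ?C" "F c = F y" by auto
    then have "c \<otimes> inv y \<in> Ker" by (simp only: F_eq_iff)
    moreover have "(c \<otimes> inv y) \<otimes> y \<in> ?C" using c(1) by (simp add: m_assoc)
    ultimately show "y \<in> (\<Union>k\<in>Ker. (\<lambda>y. k \<otimes> y) -` ?C)" by blast
  next
    fix y assume "y \<in> (\<Union>k\<in>Ker. (\<lambda>y. k \<otimes> y) -` ?C)"
    then obtain k where k: "k \<in> Ker" "k \<otimes> y \<in> ?C" by blast
    have "F (k \<otimes> y) = F y" using k(1) by (simp add: F_mult Ker_iff)
    then show "y \<in> F -` F ` ?C" using k(2) by (metis imageI vimageI2)
  qed
  have disj: "disjoint_family_on (\<lambda>k. (\<lambda>y. k \<otimes> y) -` ?C) Ker"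
    unfolding disjoint_family_on_def
  proof (intro ballI impI)
    fix k l assume kl: "k \<in> Ker" "l \<in> Ker" "k \<noteq> l"
    have False if "k \<otimes> y \<in> ?C" "l \<otimes> y \<in> ?C" for y
    proof -
      have "F (k \<otimes> y) = F (l \<otimes> y)" using kl(1,2) by (simp add: F_mult Ker_iff)
      then have "k \<otimes> y = l \<otimes> y" using inj_onD[OF inj] that by blast
      then show False using kl(3) by simp
    qed
    then show "(\<lambda>y. k \<otimes> y) -` ?C \<inter> (\<lambda>y. l \<otimes> y) -` ?C = {}" by blast
  qed
  have k: "(\<lambda>y. k \<otimes> y) -` ?C \<in> sets \<rho> \<and> measure \<rho> ((\<lambda>y. k \<otimes> y) -` ?C) = measure \<rho> ?C"
    if "k \<in> Ker" for k
  proof -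
    have "preserves_measure \<rho> (\<lambda>y. k \<otimes> y)"
      using that K distr_self_iff[OF assms(1) s borel_maps(1)] by (auto simp: stab_def)
    moreover have "?C \<in> sets \<rho>" using s by simp
    moreover have "(\<lambda>y. k \<otimes> y) -` ?C \<in> sets \<rho>"
      using measurable_sets[OF borel_maps(1)[of k], of ?C] s by simp
    ultimately show ?thesis by (simp add: preserves_measure_def sp measure_def)
  qed
  have "measure \<rho> (F -` F ` ?C) = (\<Sum>k\<in>Ker. measure \<rho> ((\<lambda>y. k \<otimes> y) -` ?C))"
    unfolding eq by (rule finite_measure_finite_Union[OF finite_Ker _ disj]) (use k in blast)
  then show ?thesis using k by simp
qed

text \<open>\<open>F\<close> is injective on long cylinders, so the mass of a cylinder can be read off from that of its
  image, which is compact and hence Borel.\<close>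

lemma Ker_invariant_measure_eqI:
  assumes "prob_space \<mu>" "prob_space \<nu>" and s: "sets \<mu> = sets borel" "sets \<nu> = sets borel"
    and K: "Ker \<subseteq> stab \<mu>" "Ker \<subseteq> stab \<nu>" and eq: "distr \<mu> borel F = distr \<nu> borel F"
  shows "\<mu> = \<nu>"
proof (rule measure_eqI_cyl[OF s, where m="nat (s - r)"])
  interpret M: prob_space \<mu> by fact
  interpret N: prob_space \<nu> by fact
  show "finite_measure \<mu>" by (rule M.finite_measure_axioms)
  fix n and x :: "int \<Rightarrow> 'a" assume n: "nat (s - r) \<le> n"
  have inj: "inj_on F (cyl n x)"
  proof (rule inj_onI)
    fix y z assume y: "y \<in> cyl n x" and z: "z \<in> cyl n x" and F: "F y = F z"
    have "y i = z i" if "0 \<le> i" "i < 0 + (s - r)" for i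
    proof -
      have "i \<in> {- int n..int n}" using that n by auto
      then show ?thesis using y z by (simp add: cyl_def)
    qed
    then show "y = z" using F by (rule image_determines)
  qed
  let ?D = "F ` cyl n x"
  have "compact ?D"
    by (intro compact_continuous_image continuous_on_subset[OF continuous] closed_imp_compact_full_shift
        closed_cyl) simp
  then have D: "?D \<in> sets borel" by (intro borel_closed compact_imp_closed_full_shift)
  have "measure \<mu> (F -` ?D) = measure \<nu> (F -` ?D)"
  proof -
    have "measure \<rho> (F -` ?D) = measure (distr \<rho> borel F) ?D"
      if "prob_space \<rho>" "sets \<rho> = sets borel" for \<rho>
      using measure_distr[OF _ D, of F \<rho>] space_mu[OF that] borel_maps(2)
      by (simp add: measurable_cong_sets[OF that(2) refl])
    then show ?thesis using assms(1,2) s eq by simp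
  qed
  then have "real (card Ker) * measure \<mu> (cyl n x) = real (card Ker) * measure \<nu> (cyl n x)"
    using measure_saturation_cyl[OF assms(1) s(1) K(1) inj] measure_saturation_cyl[OF assms(2) s(2) K(2) inj]
    by simp
  moreover have "card Ker \<noteq> 0" using finite_Ker F_one by (auto simp: card_eq_0_iff Ker_iff)
  ultimately show "emeasure \<mu> (cyl n x) = emeasure \<nu> (cyl n x)"
    by (simp add: M.emeasure_eq_measure N.emeasure_eq_measure)
qed

context
  fixes \<mu> :: "(int \<Rightarrow> 'a) measure"
  assumes prob: "prob_space \<mu>" and sets_mu: "sets \<mu> = sets borel"
    and Fp: "preserves_measure \<mu> F"
begin

interpretation prob_space \<mu> by (rule prob)

lemma translation_preserves: "d \<in> stab \<mu> \<longleftrightarrow> preserves_measure \<mu> (\<lambda>x. d \<otimes> x)"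
  using distr_self_iff[OF prob sets_mu borel_maps(1)] by (simp add: stab_def)

text \<open>The translate of \<open>\<mu>\<close> by \<open>d\<close> is still invariant under the
  kernel, by commutativity. Its image under \<open>F\<close> is the translate of
  \<open>\<mu>\<close> by \<open>F d\<close>, which is \<open>\<mu>\<close> again, so the two
  measures have the same image.\<close>

lemma stab_of_image:
  assumes K: "Ker \<subseteq> stab \<mu>" and "F d \<in> stab \<mu>"
  shows "d \<in> stab \<mu>"
proof -
  let ?\<nu> = "distr \<mu> borel (\<lambda>x. d \<otimes> x)"
  have \<nu>: "prob_space ?\<nu>" "sets ?\<nu> = sets borel"
    using borel_maps(1) by (auto intro!: prob_space_distr simp: measurable_cong_sets[OF sets_mu refl])
  have "Ker \<subseteq> stab ?\<nu>"
  proof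
    fix k assume k: "k \<in> Ker"
    have "distr ?\<nu> borel (\<lambda>x. k \<otimes> x) = distr \<mu> borel (\<lambda>x. (d \<otimes> k) \<otimes> x)"
      by (simp only: distr_mult[OF prob sets_mu, symmetric] m_comm[of d k] carrier_UNIV UNIV_I)
    also have "\<dots> = distr (distr \<mu> borel (\<lambda>x. k \<otimes> x)) borel (\<lambda>x. d \<otimes> x)"
      by (rule distr_mult[OF prob sets_mu])
    also have "distr \<mu> borel (\<lambda>x. k \<otimes> x) = \<mu>" using k K by (auto simp: stab_def)
    finally show "k \<in> stab ?\<nu>" unfolding stab_def by blast
  qed
  moreover have "distr \<mu> borel F = distr ?\<nu> borel F"
  proof -
    have F: "distr \<mu> borel F = \<mu>" using Fp distr_self_iff[OF prob sets_mu borel_maps(2)] by simp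
    have "distr ?\<nu> borel F = distr (distr \<mu> borel F) borel (\<lambda>x. F d \<otimes> x)"
      by (rule distr_hom[OF prob sets_mu borel_maps(2) F_mult])
    then show ?thesis using assms(2) F by (simp add: stab_def)
  qed
  ultimately have "\<mu> = ?\<nu>"
    by (intro Ker_invariant_measure_eqI[OF prob \<nu>(1) sets_mu \<nu>(2) K])
  then show ?thesis by (simp add: stab_def)
qed

lemma funpow_kernel_stab:
  assumes K: "Ker \<subseteq> stab \<mu>"
  shows "(F ^^ n) d = \<one> \<Longrightarrow> d \<in> stab \<mu>"
proof (induction n arbitrary: d)
  case 0
  then show ?case using subgroup.one_closed[OF subgroup_stab[OF prob sets_mu]] by simp
next
  case (Suc n)
  then have "F d \<in> stab \<mu>" by (simp add: funpow_swap1)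
  then show ?case by (rule stab_of_image[OF K])
qed

text \<open>Cylinders are clopen, so the indicators of their translates converge pointwise, and
  dominated convergence passes the invariance to the limit.\<close>

lemma closed_stab:
  assumes d: "\<And>n. d n \<in> stab \<mu>" and lim: "d \<longlonglongrightarrow> g"
  shows "g \<in> stab \<mu>"
proof -
  have sp: "space \<mu> = UNIV" by (rule space_mu[OF prob sets_mu])
  have tr: "(\<lambda>y. h \<otimes> y) -` B \<in> sets \<mu>" if "B \<in> sets borel" for h B
    using measurable_sets[OF borel_maps(1)[of h] that] sets_mu by simp
  have "distr \<mu> borel (\<lambda>x. g \<otimes> x) = \<mu>"
  proof (rule measure_eqI_cyl[where m=0])
    show "finite_measure (distr \<mu> borel (\<lambda>x. g \<otimes> x))"
      using borel_maps(1) by (intro prob_space.finite_measure prob_space_distr)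
        (simp add: measurable_cong_sets[OF sets_mu refl])
    fix n and x :: "int \<Rightarrow> 'a"
    let ?C = "cyl n x"
    have C: "?C \<in> sets borel" "?C \<in> sets \<mu>" using sets_mu by simp_all
    have "(\<lambda>k. \<integral>y. indicator ((\<lambda>y. d k \<otimes> y) -` ?C) y \<partial>\<mu>) \<longlonglongrightarrow>
        (\<integral>y. indicator ((\<lambda>y. g \<otimes> y) -` ?C) y \<partial>\<mu> :: real)"
    proof (rule integral_dominated_convergence[where w="\<lambda>_. 1"])
      show "AE y in \<mu>. (\<lambda>k. indicator ((\<lambda>y. d k \<otimes> y) -` ?C) y :: real) \<longlonglongrightarrow>
          indicator ((\<lambda>y. g \<otimes> y) -` ?C) y"
      proof (rule AE_I2)
        fix y
        have lim': "(\<lambda>k. d k \<otimes> y) \<longlonglongrightarrow> g \<otimes> y"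
          by (rule continuous_on_tendsto_compose[OF continuous_translation(2) lim]) simp_all
        have "\<forall>\<^sub>F k in sequentially. (d k \<otimes> y \<in> ?C) = (g \<otimes> y \<in> ?C)"
        proof (cases "g \<otimes> y \<in> ?C")
          case True
          from topological_tendstoD[OF lim' open_cyl this] show ?thesis
            by eventually_elim (use True in simp)
        next
          case False
          then have "g \<otimes> y \<in> - ?C" by simp
          from topological_tendstoD[OF lim' open_Compl[OF closed_cyl] this] show ?thesis
            by eventually_elim (use False in simp)
        qed
        then have "\<forall>\<^sub>F k in sequentially.
            indicator ((\<lambda>y. d k \<otimes> y) -` ?C) y = (indicator ((\<lambda>y. g \<otimes> y) -` ?C) y :: real)"
          by eventually_elim (simp add: indicator_def)
        then show "(\<lambda>k. indicator ((\<lambda>y. d k \<otimes> y) -` ?C) y :: real) \<longlonglongrightarrow>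
            indicator ((\<lambda>y. g \<otimes> y) -` ?C) y"
          by (rule tendsto_eventually)
      qed
      show "AE y in \<mu>. norm (indicator ((\<lambda>y. d k \<otimes> y) -` ?C) y :: real) \<le> 1" for k
        by (simp add: indicator_def)
    qed (intro borel_measurable_indicator tr[OF C(1)], intro borel_measurable_indicator tr[OF C(1)],
        rule integrable_const)
    then have "(\<lambda>k. measure \<mu> ((\<lambda>y. d k \<otimes> y) -` ?C)) \<longlonglongrightarrow> measure \<mu> ((\<lambda>y. g \<otimes> y) -` ?C)"
      by (simp add: sp)
    moreover have "measure \<mu> ((\<lambda>y. d k \<otimes> y) -` ?C) = measure \<mu> ?C" for k
      using d[of k] C(2) unfolding translation_preserves by (simp add: preserves_measure_def measure_def sp)
    ultimately have "measure \<mu> ((\<lambda>y. g \<otimes> y) -` ?C) = measure \<mu> ?C"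
      by (simp add: LIMSEQ_const_iff)
    then show "emeasure (distr \<mu> borel (\<lambda>x. g \<otimes> x)) ?C = emeasure \<mu> ?C"
      using borel_maps(1)[of g] C
      by (simp add: emeasure_distr measurable_cong_sets[OF sets_mu refl] sp emeasure_eq_measure)
  qed (simp_all add: sets_mu)
  then show ?thesis by (simp add: stab_def)
qed

text \<open>The kernels of the iterates of \<open>F\<close> are dense, because a preimage may be prescribed on a word.\<close>

lemma haar_of_Ker_stab:
  assumes K: "Ker \<subseteq> stab \<mu>"
  shows "haar_probability G \<mu>"
proof -
  have "g \<in> stab \<mu>" for g
  proof -
    \<comment> \<open>The window \<open>[-n, n]\<close> has \<open>2 * n + 1\<close> letters, and
      each iterate allows at least one more letter to be prescribed.\<close>
    have "\<exists>d. (F ^^ (2 * n + 1)) d = \<one> \<and> d \<in> cyl n g" for n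
    proof -
      obtain d where d: "(F ^^ (2 * n + 1)) d = \<one>"
        "\<And>i. - int n \<le> i \<Longrightarrow> i < - int n + int (2 * n + 1) * (s - r) \<Longrightarrow> d i = g i"
        using iterated_preimage_with_prefix by blast
      have le: "int (2 * n + 1) * 1 \<le> int (2 * n + 1) * (s - r)"
        using rs by (intro mult_left_mono) auto
      have "d i = g i" if "i \<in> {- int n..int n}" for i
      proof (rule d(2))
        have "i < - int n + int (2 * n + 1) * 1" using that by simp
        also note add_left_mono[OF le, of "- int n"]
        finally show "i < - int n + int (2 * n + 1) * (s - r)" .
      qed (use that in simp)
      then have "d \<in> cyl n g" by (simp add: cyl_def)
      with d(1) show ?thesis by blast
    qed
    then obtain d where d: "\<And>n. (F ^^ (2 * n + 1)) (d n) = \<one>" "\<And>n. d n \<in> cyl n g" by metis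
    have "d \<longlonglongrightarrow> g"
    proof (rule topological_tendstoI)
      fix U assume "open U" "g \<in> U"
      then obtain k where k: "cyl k g \<subseteq> U" by (rule open_contains_cyl)
      show "\<forall>\<^sub>F n in sequentially. d n \<in> U"
        using eventually_ge_at_top[of k]
      proof eventually_elim
        case (elim n)
        then show ?case using d(2)[of n] cyl_mono[OF elim] k by blast
      qed
    qed
    moreover have "d n \<in> stab \<mu>" for n by (rule funpow_kernel_stab[OF K d(1)])
    ultimately show ?thesis by (rule closed_stab[rotated])
  qed
  then have "preserves_measure \<mu> (\<lambda>x. g \<otimes> x)" for g by (simp add: translation_preserves)
  then show ?thesis
    unfolding haar_probability_def borel_probability_def preserves_measure_def
    using prob sets_mu space_mu[OF prob sets_mu] by simp
qed

text \<open>A nontrivial translate by a kernel element is singular to \<open>\<mu>\<close>, being ergodic for the power of the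
  shift which fixes that element; so \<open>F\<close> is injective on a set of full measure.\<close>

lemma injective_on_full_measure_set:
  assumes \<sigma>: "totally_ergodic \<mu> shift_map" and triv: "Ker \<inter> stab \<mu> = {\<one>}"
  shows "\<exists>E\<in>sets \<mu>. measure \<mu> E = 1 \<and> inj_on F E"
proof -
  have sp: "space \<mu> = UNIV" by (rule space_mu[OF prob sets_mu])
  have tr: "(\<lambda>y. h \<otimes> y) -` B \<in> sets \<mu>" if "B \<in> sets \<mu>" for h B
    using measurable_sets[OF borel_maps(1)[of h], of B] that sets_mu by simp
  have trm: "(\<lambda>y. h \<otimes> y) \<in> \<mu> \<rightarrow>\<^sub>M borel" for h
    using borel_maps(1)[of h] by (simp add: measurable_cong_sets[OF sets_mu refl])
  have "\<exists>E\<in>sets \<mu>. measure \<mu> E = 1 \<and> measure \<mu> ((\<lambda>y. d \<otimes> y) -` E) = 0" if d: "d \<in> Ker - {\<one>}" for d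
  proof -
    let ?\<nu> = "distr \<mu> borel (\<lambda>x. d \<otimes> x)"
    have \<nu>: "prob_space ?\<nu>" "sets ?\<nu> = sets \<mu>"
      using trm sets_mu by (auto intro!: prob_space_distr)
    obtain k where k: "k \<ge> 1" "(shift_map ^^ k) d = d"
      using shift_periodic_Ker d by blast
    let ?T = "shift_map ^^ k :: (int \<Rightarrow> 'a) \<Rightarrow> _" and ?T' = "unshift_map ^^ k :: (int \<Rightarrow> 'a) \<Rightarrow> _"
    have erg: "ergodic \<mu> ?T" using \<sigma> k(1) by (simp add: totally_ergodic_def)
    then have Tm: "?T \<in> \<mu> \<rightarrow>\<^sub>M \<mu>" by (simp add: ergodic_def preserves_measure_def)
    \<comment> \<open>Since \<open>?T\<close> fixes \<open>d\<close>, translation by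
      \<open>d\<close> commutes with \<open>?T\<close>, and ergodicity passes to the translated
      measure.\<close>
    have comm: "?T (d \<otimes> x) = d \<otimes> ?T x" for x
    proof -
      have "(shift_map ^^ j) (a \<otimes> b) = (shift_map ^^ j) a \<otimes> (shift_map ^^ j) b" for j a b
        by (induction j) (simp_all add: shift_mult)
      then show ?thesis using k(2) by simp
    qed
    have vT: "(\<lambda>x. d \<otimes> x) -` ?T -` B = ?T -` (\<lambda>x. d \<otimes> x) -` B" for B
      using comm by auto
    have em: "emeasure ?\<nu> B = emeasure \<mu> ((\<lambda>x. d \<otimes> x) -` B)" if "B \<in> sets \<mu>" for B
      using emeasure_distr[OF trm, of B d] that sets_mu by (simp add: sp)
    have vTm: "?T -` B \<in> sets \<mu>" if "B \<in> sets \<mu>" for B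
      using measurable_sets[OF Tm that] by (simp add: sp)
    have "ergodic ?\<nu> ?T"
      unfolding ergodic_def preserves_measure_def
    proof (intro conjI ballI impI)
      show "?T \<in> ?\<nu> \<rightarrow>\<^sub>M ?\<nu>" using Tm by (simp add: measurable_cong_sets[OF \<nu>(2) \<nu>(2)])
      fix B assume "B \<in> sets ?\<nu>"
      then have B: "B \<in> sets \<mu>" using \<nu>(2) by simp
      show "emeasure ?\<nu> (?T -` B \<inter> space ?\<nu>) = emeasure ?\<nu> B"
        using erg tr[OF B, of d] vTm[OF B] B
        by (simp add: em vT ergodic_def preserves_measure_def sp)
      assume "?T -` B \<inter> space ?\<nu> = B"
      then have "?T -` (\<lambda>x. d \<otimes> x) -` B \<inter> space \<mu> = (\<lambda>x. d \<otimes> x) -` B"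
        by (simp add: vT[symmetric] sp)
      then have "measure \<mu> ((\<lambda>x. d \<otimes> x) -` B) = 0 \<or> measure \<mu> ((\<lambda>x. d \<otimes> x) -` B) = 1"
        using erg tr[OF B, of d] by (simp add: ergodic_def)
      then show "measure ?\<nu> B = 0 \<or> measure ?\<nu> B = 1"
        using em[OF B] by (simp add: measure_def)
    qed
    moreover have "?T' \<in> \<mu> \<rightarrow>\<^sub>M \<mu>"
    proof -
      have "preserves_measure \<mu> shift_map"
        using \<sigma> by (auto simp: totally_ergodic_def ergodic_def dest: spec[of _ 1])
      from preserves_measure_funpow[OF preserves_unshift[OF prob sets_mu this]]
      show ?thesis by (simp add: preserves_measure_def)
    qed
    moreover have "?T' (?T x) = x" "?T (?T' x) = x" for x
    proof -
      show "(unshift_map ^^ j) ((shift_map ^^ j) x) = x" for j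
        by (induction j) (simp_all add: funpow_swap1[of unshift_map])
      show "(shift_map ^^ j) ((unshift_map ^^ j) x) = x" for j
        by (induction j) (simp_all add: funpow_swap1[of shift_map])
    qed
    ultimately have "\<mu> = ?\<nu> \<or> (\<exists>E\<in>sets \<mu>. measure \<mu> E = 1 \<and> measure ?\<nu> E = 0)"
      using erg by (intro ergodic_eq_or_singular[OF prob \<nu> sp, of ?T ?T'])
    moreover have "\<mu> \<noteq> ?\<nu>"
    proof
      assume "\<mu> = ?\<nu>"
      then have "d \<in> stab \<mu>" by (simp add: stab_def)
      then show False using d triv by blast
    qed
    ultimately show ?thesis using em by (auto simp: measure_def)
  qed
  then obtain E where E: "\<And>d. d \<in> Ker - {\<one>} \<Longrightarrow> E d \<in> sets \<mu>"
    "\<And>d. d \<in> Ker - {\<one>} \<Longrightarrow> measure \<mu> (E d) = 1"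
    "\<And>d. d \<in> Ker - {\<one>} \<Longrightarrow> measure \<mu> ((\<lambda>y. d \<otimes> y) -` E d) = 0"
    by metis
  \<comment> \<open>Membership of \<open>x\<close> and \<open>d \<otimes> x\<close> in
    \<open>A\<close> is contradictory: the former forces \<open>d \<otimes> x \<notin> E d\<close>,
    the latter the opposite. Hence no two points of \<open>A\<close> differ by a nontrivial kernel
    element.\<close>
  define A where "A = {x. \<forall>d\<in>Ker - {\<one>}. x \<in> E d \<and> d \<otimes> x \<notin> E d}"
  have A_eq: "A = space \<mu> - (\<Union>d\<in>Ker - {\<one>}. (space \<mu> - E d) \<union> (\<lambda>y. d \<otimes> y) -` E d)"
    by (auto simp: A_def sp)
  have As: "A \<in> sets \<mu>"
    unfolding A_eq using finite_Ker E(1) tr by (intro sets.Diff sets.top sets.finite_UN sets.Un) auto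
  have "AE x in \<mu>. \<forall>d\<in>Ker - {\<one>}. x \<in> E d \<and> d \<otimes> x \<notin> E d"
  proof (rule AE_finite_allI)
    show "finite (Ker - {\<one>})" using finite_Ker by simp
    fix d assume d: "d \<in> Ker - {\<one>}"
    have "AE x in \<mu>. x \<in> E d" using E(1,2)[OF d] by (simp add: prob_eq_1)
    moreover have "AE x in \<mu>. x \<notin> (\<lambda>y. d \<otimes> y) -` E d"
      using E(3)[OF d] tr[OF E(1)[OF d]] by (simp add: prob_eq_0)
    ultimately show "AE x in \<mu>. x \<in> E d \<and> d \<otimes> x \<notin> E d" by eventually_elim simp
  qed
  then have "AE x in \<mu>. x \<in> A" by (simp add: A_def)
  then have "measure \<mu> A = 1" using As by (simp add: prob_eq_1)
  moreover have "inj_on F A"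
  proof (rule inj_onI, rule ccontr)
    fix x y assume x: "x \<in> A" and y: "y \<in> A" and F: "F x = F y" and "x \<noteq> y"
    let ?d = "y \<otimes> inv x"
    have dx: "?d \<otimes> x = y" by (simp add: m_assoc)
    have "?d \<in> Ker" using F by (simp only: F_eq_iff[symmetric])
    moreover have "?d \<noteq> \<one>" using dx \<open>x \<noteq> y\<close> by auto
    ultimately have "?d \<in> Ker - {\<one>}" by blast
    then have "y \<in> E ?d" "?d \<otimes> x \<notin> E ?d" using x y unfolding A_def by blast+
    then show False using dx by simp
  qed
  ultimately show ?thesis using As by blast
qed

end

end

theorem corollary4p3:
  fixes G :: "(int \<Rightarrow> 'a::alphabet) monoid"
    and F :: "(int \<Rightarrow> 'a) \<Rightarrow> (int \<Rightarrow> 'a)"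
    and \<mu> :: "(int \<Rightarrow> 'a) measure"
  assumes "abelian_group_shift G"
    and "algebraic_ca G F"
    and "nontrivial_ca F"
    and "bipermutative F"
    and "borel_probability \<mu>"
    and "preserves_measure \<mu> F"
    and "preserves_measure \<mu> shift_map"
    and "totally_ergodic \<mu> shift_map"
    and "ks_entropy \<mu> F > 0"
    and "\<And>\<Gamma>. subgroup \<Gamma> G \<Longrightarrow> \<Gamma> \<subseteq> kernel G G F \<Longrightarrow> shift_map ` \<Gamma> = \<Gamma> \<Longrightarrow>
            \<Gamma> = {\<one>\<^bsub>G\<^esub>} \<or> \<Gamma> = kernel G G F"
  shows "\<mu> = haar_measure G"
proof -
  have prob: "prob_space \<mu>" and sets: "sets \<mu> = sets borel"
    using assms(5) by (simp_all add: borel_probability_def)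
  have ca: "cellular_automaton F" and hom: "F \<in> hom G G"
    using assms(2) by (simp_all add: algebraic_ca_def)
  obtain r s where "permutative_ca F r s"
    using permutative_ca_of_bipermutative[OF ca assms(3,4)] .
  then interpret permutative_algebraic_ca F r s G
    using assms(1) hom by (simp add: permutative_algebraic_ca_def permutative_algebraic_ca_axioms_def)
  \<comment> \<open>The hypothesis on subgroups of the kernel is applied to this one. It concerns
    strict invariance, so the inverse shift is treated as well.\<close>
  let ?H = "Ker \<inter> stab \<mu>"
  have "subgroup ?H G"
    using group_hom.subgroup_kernel[of G G F] hom is_group subgroup_stab[OF prob sets]
    by (intro subgroups_Inter_pair) (simp_all add: group_hom_def group_hom_axioms_def)
  moreover have "shift_map ` ?H = ?H"
  proof
    have sh: "shift_map d \<in> ?H" if "d \<in> ?H" for d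
      using that shift_Ker stab_hom[OF prob sets borel_maps(3) shift_mult assms(7)] by blast
    then show "shift_map ` ?H \<subseteq> ?H" by blast
    show "?H \<subseteq> shift_map ` ?H"
    proof
      fix d assume d: "d \<in> ?H"
      then obtain e where e: "e \<in> Ker" "d = shift_map e" using shift_Ker by blast
      have "unshift_map d \<in> stab \<mu>"
        using d stab_hom[OF prob sets borel_maps(4) unshift_mult preserves_unshift[OF prob sets assms(7)]]
        by blast
      then show "d \<in> shift_map ` ?H" using e by auto
    qed
  qed
  ultimately have "?H = {\<one>\<^bsub>G\<^esub>} \<or> ?H = Ker" by (intro assms(10)) auto
  moreover have "?H \<noteq> {\<one>\<^bsub>G\<^esub>}"
  proof
    assume "?H = {\<one>\<^bsub>G\<^esub>}"
    then obtain E where "E \<in> sets \<mu>" "measure \<mu> E = 1" "inj_on F E"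
      using injective_on_full_measure_set[OF prob sets assms(6,8)] by blast
    then have "ks_entropy \<mu> F \<le> 0" by (rule ks_entropy_le_0[OF prob sets assms(6,7)])
    then show False using assms(9) by simp
  qed
  ultimately have "Ker \<subseteq> stab \<mu>" by blast
  then show ?thesis
    by (intro haar_measure_eqI[OF assms(1)] haar_of_Ker_stab[OF prob sets assms(6)])
qed

end
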